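(* Assume $f$ is $C^2$, each $g_i$ is a non-constant $C^2$ function, and the bounded measurable functions $w_i$ satisfy, for every $i=1,\dots,m$, \[ \int_{t_k}^{t_{k+1}}\big(v_i(t)-w_i(t)\big)\,dt=0,\qquad \int_{t_k}^{t_{k+1}}(t-t_{k+1/2})\big(v_i(t)-w_i(t)\big)\,dt=0. \] Then the local error is $O(h_k^2)$. Moreover, if each $w_i$ is affine (the unique affine function satisfying these two conditions), then with $E=\frac{e^{\Lambda h_k}-1}{\Lambda h_k}$, \[ \Big(1-\frac{Lh_k}{2}-h_kL'\Big)\|x(t_{k+1})-y(t_{k+1})\|\le\frac{h_k^2}{4}L'\Big(11K+\tfrac{69}{2}K'\Big)+\frac{7h_k^3}{8}K'\Big((4H'+H)\big(K+\tfrac52K'\big)+L^2+\big(\tfrac92L+5L'\big)L'\Big)E+\frac{7h_k^3}{48}(HK'+LL')(K+K'). \]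
   Context: Setting: for $m\ge 1$ consider on $\mathbb{R}^n$ the input-affine system $\dot x(t)=f(x(t))+\sum_{i=1}^m g_i(x(t))v_i(t)$, where $f,g_i:\mathbb{R}^n\to\mathbb{R}^n$ and each $v_i$ is a Lebesgue measurable function with $|v_i(t)|\le V_i$ for some $V_i>0$. Fix a time step $[t_k,t_{k+1}]$ with $h_k=t_{k+1}-t_k>0$ and $t_{k+1/2}=(t_k+t_{k+1})/2$, and let $x$ be a solution on $[t_k,t_{k+1}]$. Given real-valued bounded measurable functions $w_i$ on $[t_k,t_{k+1}]$, let $y$ be the solution of the approximate system $\dot y(t)=f(y(t))+\sum_{i=1}^m g_i(y(t))w_i(t)$ with $y(t_k)=x(t_k)$. Norms: $\|x\|=\max_j|x_j|$ on $\mathbb{R}^n$, the induced matrix norm $\|Q\|=\max_k\sum_i|q_{ki}|$, and the logarithmic norm $\lambda(Q)=\max_k\big(q_{kk}+\sum_{i\neq k}|q_{ki}|\big)$. Standing bounds: there is a convex set $B$ containing $x(t)$ and $y(t)$ for all $t\in[t_k,t_{k+1}]$ on which $\|f\|\le K$, $\|g_i\|\le K_i$, $\|Df\|\le L$, $\|Dg_i\|\le L_i$, $\|D^2f\|\le H$, $\|D^2g_i\|\le H_i$ (whenever these derivatives exist; $D$ is the Jacobian, $D^2$ the second derivative) and $\lambda(Df)\le\Lambda$, with $\Lambda\neq 0$. Put $K'=\sum_{i=1}^m V_iK_i$, $L'=\sum_{i=1}^m V_iL_i$, $H'=\sum_{i=1}^m V_iH_i$. *)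

theory Defs
  imports "HOL-Analysis.Analysis"
begin

definition mnorm :: "real^'n \<Rightarrow> real" where
  "mnorm x = (MAX j\<in>UNIV. \<bar>x $ j\<bar>)"

definition mat_norm :: "real^'n^'n \<Rightarrow> real" where
  "mat_norm Q = (MAX k\<in>UNIV. (\<Sum>i\<in>UNIV. \<bar>Q $ k $ i\<bar>))"

definition log_norm :: "real^'n^'n \<Rightarrow> real" where
  "log_norm Q = (MAX k\<in>UNIV. Q $ k $ k + (\<Sum>i\<in>UNIV - {k}. \<bar>Q $ k $ i\<bar>))"

definition Jac :: "(real^'n \<Rightarrow> real^'n) \<Rightarrow> real^'n \<Rightarrow> real^'n^'n" where
  "Jac f x = matrix (frechet_derivative f (at x))"

definition D2 :: "(real^'n \<Rightarrow> real^'n) \<Rightarrow> real^'n \<Rightarrow> real^'n \<Rightarrow> real^'n \<Rightarrow> real^'n" where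
  "D2 f x u v = frechet_derivative (Jac f) (at x) u *v v"

definition d2_norm :: "(real^'n \<Rightarrow> real^'n) \<Rightarrow> real^'n \<Rightarrow> real" where
  "d2_norm f x = (SUP uv\<in>{(u,v). mnorm u \<le> 1 \<and> mnorm v \<le> 1}. mnorm (D2 f x (fst uv) (snd uv)))"

definition C2 :: "(real^'n \<Rightarrow> real^'n) \<Rightarrow> bool" where
  "C2 f \<longleftrightarrow> (\<forall>x. f differentiable (at x)) \<and> (\<forall>x. Jac f differentiable (at x)) \<and>
     (\<forall>u. continuous_on UNIV (\<lambda>x. frechet_derivative (Jac f) (at x) u))"

text \<open>(Caratheodory) solution on [a,b] of z' = f z + sum_i u_i(t) g_i z, in integral form.\<close>
definition is_sol :: "(real^'n \<Rightarrow> real^'n) \<Rightarrow> (nat \<Rightarrow> real^'n \<Rightarrow> real^'n) \<Rightarrow> nat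
     \<Rightarrow> (nat \<Rightarrow> real \<Rightarrow> real) \<Rightarrow> real \<Rightarrow> real \<Rightarrow> (real \<Rightarrow> real^'n) \<Rightarrow> bool" where
  "is_sol f g m u a b z \<longleftrightarrow> (\<forall>t\<in>{a..b}.
     ((\<lambda>s. f (z s) + (\<Sum>i\<in>{1..m}. u i s *\<^sub>R g i (z s))) has_integral (z t - z a)) {a..t})"

end

theory Submission
  imports Defs
begin

text \<open>
  Write \<open>e = x - y\<close>, \<open>d\<^sub>i = v\<^sub>i - w\<^sub>i\<close> and let \<open>c\<close> be the midpoint of the step \<open>[a, b]\<close> of length \<open>h\<close>. Then
  \[ e(b) = \int (f(x) - f(y)) + \sum_i \int (d_i\, g_i(x) + w_i\, (g_i(x) - g_i(y))). \]
  Since \<open>d\<^sub>i\<close> has mean zero, \<open>g\<^sub>i(x(t))\<close> may be replaced by \<open>g\<^sub>i(x(t)) - g\<^sub>i(x(c))\<close>, which is \<open>O(h)\<close>, and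
  \<open>e(t) = O(t - a)\<close>; this already gives a local error \<open>O(h\<^sup>2)\<close>.

  For affine \<open>w\<^sub>i\<close> the two moment conditions say that \<open>w\<^sub>i\<close> is the \<open>L\<^sup>2\<close>-orthogonal projection of \<open>v\<^sub>i\<close>, so
  that \<open>w\<^sub>i\<close> and \<open>d\<^sub>i\<close> have \<open>L\<^sup>2\<close>-norm at most that of \<open>v\<^sub>i\<close>, and \<open>\<bar>w\<^sub>i\<bar> \<le> 2 V\<^sub>i\<close>. Moreover the first integral
  is integrated by parts against \<open>t - c\<close>: the boundary term is at most \<open>(L h / 2) \<parallel>e(b)\<parallel>\<close>; in the remaining
  integral the terms with \<open>d\<^sub>i\<close> are \<open>O(h\<^sup>3)\<close> because \<open>(t - c) d\<^sub>i\<close> has mean zero, and the others are controlled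
  by \<open>sup \<parallel>e\<parallel> \<le> 3 K' h E\<close>, a one-sided Gronwall estimate with the logarithmic norm.
\<close>

subsection \<open>The maximum norm\<close>

lemma mnorm_eq_infnorm: "mnorm x = infnorm x"
  unfolding mnorm_def infnorm_cart
  by (subst cSup_eq_Max) (auto simp: full_SetCompr_eq)

lemma infnorm_leI:
  fixes x :: "'a::euclidean_space"
  assumes "\<And>i. i \<in> Basis \<Longrightarrow> \<bar>x \<bullet> i\<bar> \<le> c"
  shows "infnorm x \<le> c"
  unfolding infnorm_Max using assms by simp

lemma infnorm_cart_leI:
  fixes x :: "real^'n"
  assumes "\<And>k. \<bar>x $ k\<bar> \<le> c"
  shows "infnorm x \<le> c"
  using assms by (auto intro!: infnorm_leI simp: Basis_vec_def inner_axis)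

lemma infnorm_real: "infnorm (x::real) = \<bar>x\<bar>"
  by (simp add: infnorm_Max)

lemma infnorm_triangle_diff: "infnorm (x - y) \<le> infnorm x + infnorm y"
  using infnorm_triangle[of x "- y"] by (simp add: infnorm_neg)

lemma infnorm_sum_le:
  fixes F :: "'i \<Rightarrow> 'a::euclidean_space"
  shows "infnorm (sum F I) \<le> (\<Sum>i\<in>I. infnorm (F i))"
proof (induction I rule: infinite_finite_induct)
  case (insert i I)
  then show ?case
    using infnorm_triangle[of "F i" "sum F I"] by simp
qed (simp_all add: infnorm_0)

lemma infnorm_mean_value_le:
  fixes \<phi> :: "'a::real_normed_vector \<Rightarrow> 'b::euclidean_space"
  assumes convex_mem: "convex S" "p \<in> S" "q \<in> S"
    and deriv: "\<And>z. z \<in> S \<Longrightarrow> (\<phi> has_derivative \<phi>' z) (at z within S)"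
    and bound: "\<And>z. z \<in> S \<Longrightarrow> infnorm (\<phi>' z (p - q)) \<le> c"
  shows "infnorm (\<phi> p - \<phi> q) \<le> c"
proof (rule infnorm_leI)
  fix i :: 'b assume i_Basis: "i \<in> Basis"
  define \<gamma> where "\<gamma> \<theta> = q + \<theta> *\<^sub>R (p - q)" for \<theta> :: real
  have \<gamma>_mem: "\<gamma> \<theta> \<in> S" if "\<theta> \<in> {0..1}" for \<theta>
  proof -
    have "(1 - \<theta>) *\<^sub>R q + \<theta> *\<^sub>R p \<in> S"
      using that convex_mem by (intro convexD) auto
    then show ?thesis by (simp add: \<gamma>_def algebra_simps)
  qed
  have "\<exists>\<theta>\<in>{0..1}. \<phi> (\<gamma> 1) \<bullet> i - \<phi> (\<gamma> 0) \<bullet> i = (\<lambda>r. \<phi>' (\<gamma> \<theta>) (r *\<^sub>R (p - q)) \<bullet> i) (1 - 0)"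
  proof (rule mvt_very_simple)
    fix \<theta> :: real assume \<theta>_range: "0 \<le> \<theta>" "\<theta> \<le> 1"
    have "(\<gamma> has_derivative (\<lambda>r. r *\<^sub>R (p - q))) (at \<theta> within {0..1})"
      unfolding \<gamma>_def by (auto intro!: derivative_eq_intros)
    with \<gamma>_mem \<theta>_range have "((\<lambda>\<theta>. \<phi> (\<gamma> \<theta>)) has_derivative (\<lambda>r. \<phi>' (\<gamma> \<theta>) (r *\<^sub>R (p - q)))) (at \<theta> within {0..1})"
      by (intro has_derivative_in_compose2[OF deriv]) auto
    then show "((\<lambda>\<theta>. \<phi> (\<gamma> \<theta>) \<bullet> i) has_derivative (\<lambda>r. \<phi>' (\<gamma> \<theta>) (r *\<^sub>R (p - q)) \<bullet> i))
        (at \<theta> within {0..1})"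
      by (rule has_derivative_inner_left)
  qed simp
  then obtain \<theta> where \<theta>_mvt: "\<theta> \<in> {0..1}" "\<phi> p \<bullet> i - \<phi> q \<bullet> i = \<phi>' (\<gamma> \<theta>) (p - q) \<bullet> i"
    by (auto simp: \<gamma>_def)
  have "\<bar>(\<phi> p - \<phi> q) \<bullet> i\<bar> \<le> infnorm (\<phi>' (\<gamma> \<theta>) (p - q))"
    using Basis_le_infnorm[OF i_Basis] by (simp add: inner_diff_left \<theta>_mvt(2))
  also have "\<dots> \<le> c"
    by (intro bound \<gamma>_mem \<theta>_mvt(1))
  finally show "\<bar>(\<phi> p - \<phi> q) \<bullet> i\<bar> \<le> c" .
qed

definition infnorm_lipschitz_on ::
  "real \<Rightarrow> 'a::euclidean_space set \<Rightarrow> ('a \<Rightarrow> 'b::euclidean_space) \<Rightarrow> bool" where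
  "infnorm_lipschitz_on C S \<phi> \<longleftrightarrow>
    0 \<le> C \<and> (\<forall>p\<in>S. \<forall>q\<in>S. infnorm (\<phi> p - \<phi> q) \<le> C * infnorm (p - q))"

lemma infnorm_lipschitz_onD:
  "infnorm_lipschitz_on C S \<phi> \<Longrightarrow> p \<in> S \<Longrightarrow> q \<in> S \<Longrightarrow> infnorm (\<phi> p - \<phi> q) \<le> C * infnorm (p - q)"
  by (simp add: infnorm_lipschitz_on_def)

lemma infnorm_lipschitz_on_nonneg: "infnorm_lipschitz_on C S \<phi> \<Longrightarrow> 0 \<le> C"
  by (simp add: infnorm_lipschitz_on_def)

lemma infnorm_lipschitz_on_compose:
  assumes \<phi>_lipschitz: "infnorm_lipschitz_on C T \<phi>" and z_lipschitz: "infnorm_lipschitz_on D S z"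
    and z_image: "z ` S \<subseteq> T"
  shows "infnorm_lipschitz_on (C * D) S (\<lambda>t. \<phi> (z t))"
  unfolding infnorm_lipschitz_on_def
proof (intro conjI ballI)
  show "0 \<le> C * D"
    using \<phi>_lipschitz z_lipschitz by (intro mult_nonneg_nonneg infnorm_lipschitz_on_nonneg)
  fix s t assume mem: "s \<in> S" "t \<in> S"
  then have "infnorm (\<phi> (z s) - \<phi> (z t)) \<le> C * infnorm (z s - z t)"
    using z_image by (intro infnorm_lipschitz_onD[OF \<phi>_lipschitz]) auto
  also have "\<dots> \<le> C * (D * infnorm (s - t))"
    by (intro mult_left_mono infnorm_lipschitz_onD[OF z_lipschitz] infnorm_lipschitz_on_nonneg[OF \<phi>_lipschitz] mem)
  finally show "infnorm (\<phi> (z s) - \<phi> (z t)) \<le> C * D * infnorm (s - t)"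
    by (simp add: mult.assoc)
qed

lemma infnorm_lipschitz_on_imp_continuous_on:
  fixes \<phi> :: "'a::euclidean_space \<Rightarrow> 'b::euclidean_space"
  assumes "infnorm_lipschitz_on C S \<phi>"
  shows "continuous_on S \<phi>"
proof (rule lipschitz_on_continuous_on[OF lipschitz_onI])
  have "0 \<le> C" by (rule infnorm_lipschitz_on_nonneg[OF assms])
  then show "0 \<le> sqrt DIM('b) * C" by simp
  fix p q assume "p \<in> S" "q \<in> S"
  have "norm (\<phi> p - \<phi> q) \<le> sqrt DIM('b) * infnorm (\<phi> p - \<phi> q)"
    by (rule norm_le_infnorm)
  also have "\<dots> \<le> sqrt DIM('b) * (C * infnorm (p - q))"
    by (intro mult_left_mono infnorm_lipschitz_onD[OF assms] \<open>p \<in> S\<close> \<open>q \<in> S\<close>) simp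
  also have "\<dots> \<le> sqrt DIM('b) * (C * norm (p - q))"
    using \<open>0 \<le> C\<close> by (intro mult_left_mono infnorm_le_norm) auto
  finally show "dist (\<phi> p) (\<phi> q) \<le> sqrt DIM('b) * C * dist p q"
    by (simp add: dist_norm mult.assoc)
qed

lemma infnorm_lipschitz_on_derivative_bound:
  fixes \<phi> :: "'a::euclidean_space \<Rightarrow> 'b::euclidean_space"
  assumes "convex S" "0 \<le> C"
    and "\<And>z. z \<in> S \<Longrightarrow> (\<phi> has_derivative \<phi>' z) (at z within S)"
    and "\<And>z h. z \<in> S \<Longrightarrow> infnorm (\<phi>' z h) \<le> C * infnorm h"
  shows "infnorm_lipschitz_on C S \<phi>"
  unfolding infnorm_lipschitz_on_def
  by (intro conjI ballI assms(2) infnorm_mean_value_le[OF assms(1) _ _ assms(3)] assms(4))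

subsection \<open>Row-sum norm, logarithmic norm and second derivative\<close>

lemma infnorm_matrix_vector_mult_le:
  "infnorm (A *v u) \<le> mat_norm A * infnorm u"
proof (rule infnorm_cart_leI)
  fix k
  have "\<bar>(A *v u) $ k\<bar> \<le> (\<Sum>i\<in>UNIV. \<bar>A $ k $ i\<bar> * infnorm u)"
    unfolding matrix_vector_mult_def
    by (auto simp: abs_mult intro!: order_trans[OF sum_abs] sum_mono mult_left_mono component_le_infnorm_cart)
  also have "\<dots> \<le> mat_norm A * infnorm u"
    unfolding sum_distrib_right[symmetric] mat_norm_def
    by (intro mult_right_mono infnorm_pos_le Max_ge) auto
  finally show "\<bar>(A *v u) $ k\<bar> \<le> mat_norm A * infnorm u" .
qed

lemma mat_norm_nonneg: "0 \<le> mat_norm A"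
  unfolding mat_norm_def by (subst Max_ge_iff) (auto intro!: sum_nonneg)

lemma abs_diagonal_le_mat_norm: "\<bar>A $ k $ k\<bar> \<le> mat_norm A"
proof -
  have "\<bar>A $ k $ k\<bar> \<le> (\<Sum>i\<in>UNIV. \<bar>A $ k $ i\<bar>)"
    by (rule member_le_sum) auto
  also have "\<dots> \<le> mat_norm A"
    unfolding mat_norm_def by (rule Max_ge) auto
  finally show ?thesis .
qed

lemma infnorm_euler_step_le_log_norm:
  fixes A :: "real^'n^'n"
  assumes \<delta>_bounds: "0 \<le> \<delta>" "\<delta> * mat_norm A \<le> 1"
  shows "infnorm (u + \<delta> *\<^sub>R (A *v u)) \<le> (1 + \<delta> * log_norm A) * infnorm u"
proof (rule infnorm_cart_leI)
  fix k
  let ?offdiag = "\<Sum>i\<in>UNIV - {k}. \<bar>A $ k $ i\<bar>"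
  have row_split: "sum r UNIV = r k + sum r (UNIV - {k})" for r :: "'n \<Rightarrow> real"
    by (rule sum.remove) auto
  have "\<delta> * \<bar>A $ k $ k\<bar> \<le> 1"
    using mult_left_mono[OF abs_diagonal_le_mat_norm[of A k] \<delta>_bounds(1)] \<delta>_bounds(2) by linarith
  then have diag: "0 \<le> 1 + \<delta> * A $ k $ k"
    using \<delta>_bounds(1) abs_ge_minus_self[of "\<delta> * A $ k $ k"] by (simp add: abs_mult)
  have "(u + \<delta> *\<^sub>R (A *v u)) $ k
      = (1 + \<delta> * A $ k $ k) * u $ k + \<delta> * (\<Sum>i\<in>UNIV - {k}. A $ k $ i * u $ i)"
    unfolding matrix_vector_mult_def by (simp add: row_split algebra_simps)
  also have "\<bar>\<dots>\<bar> \<le> (1 + \<delta> * A $ k $ k) * infnorm u + \<delta> * (?offdiag * infnorm u)"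
  proof (rule order_trans[OF abs_triangle_ineq add_mono])
    show "\<bar>(1 + \<delta> * A $ k $ k) * u $ k\<bar> \<le> (1 + \<delta> * A $ k $ k) * infnorm u"
      using diag by (simp add: abs_mult mult_left_mono component_le_infnorm_cart)
    have "\<bar>\<Sum>i\<in>UNIV - {k}. A $ k $ i * u $ i\<bar> \<le> ?offdiag * infnorm u"
      unfolding sum_distrib_right
      by (auto simp: abs_mult intro!: order_trans[OF sum_abs] sum_mono mult_left_mono component_le_infnorm_cart)
    then show "\<bar>\<delta> * (\<Sum>i\<in>UNIV - {k}. A $ k $ i * u $ i)\<bar> \<le> \<delta> * (?offdiag * infnorm u)"
      using \<delta>_bounds(1) by (simp add: abs_mult mult_left_mono)
  qed
  also have "\<dots> = (1 + \<delta> * (A $ k $ k + ?offdiag)) * infnorm u"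
    by (simp add: algebra_simps)
  also have "\<dots> \<le> (1 + \<delta> * log_norm A) * infnorm u"
    unfolding log_norm_def using \<delta>_bounds(1)
    by (intro mult_right_mono infnorm_pos_le add_left_mono mult_left_mono Max_ge) auto
  finally show "\<bar>(u + \<delta> *\<^sub>R (A *v u)) $ k\<bar> \<le> (1 + \<delta> * log_norm A) * infnorm u" .
qed

lemma bdd_above_infnorm_bilinear_unit_balls:
  fixes h :: "'a::euclidean_space \<Rightarrow> 'b::euclidean_space \<Rightarrow> 'c::euclidean_space"
  assumes "bilinear h"
  shows "bdd_above ((\<lambda>uv. infnorm (h (fst uv) (snd uv))) ` {(u, v). infnorm u \<le> 1 \<and> infnorm v \<le> 1})"
proof -
  obtain C where C_bound: "C > 0" "\<And>u v. norm (h u v) \<le> C * norm u * norm v"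
    using bilinear_bounded_pos[OF assms] by blast
  have norm_le: "norm r \<le> sqrt DIM('d)" if "infnorm r \<le> 1" for r :: "'d::euclidean_space"
    using order_trans[OF norm_le_infnorm mult_left_mono[OF that]] by simp
  have "infnorm (h u v) \<le> C * sqrt DIM('a) * sqrt DIM('b)" if "infnorm u \<le> 1" "infnorm v \<le> 1" for u v
  proof -
    have "infnorm (h u v) \<le> C * norm u * norm v"
      using infnorm_le_norm C_bound(2) by (rule order_trans)
    also have "\<dots> \<le> C * sqrt DIM('a) * sqrt DIM('b)"
      using C_bound(1) that by (intro mult_mono norm_le) auto
    finally show ?thesis .
  qed
  then show ?thesis by (intro bdd_aboveI2) auto
qed

lemma infnorm_bilinear_le_SUP:
  fixes h :: "'a::euclidean_space \<Rightarrow> 'b::euclidean_space \<Rightarrow> 'c::euclidean_space"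
  assumes h_bilinear: "bilinear h"
  shows "infnorm (h u v)
    \<le> (SUP uv\<in>{(u, v). infnorm u \<le> 1 \<and> infnorm v \<le> 1}. infnorm (h (fst uv) (snd uv))) * infnorm u * infnorm v"
    (is "_ \<le> ?sup * _ * _")
proof (cases "u = 0 \<or> v = 0")
  case True
  then show ?thesis
    using bilinear_lzero[OF h_bilinear] bilinear_rzero[OF h_bilinear] by (auto simp: infnorm_0)
next
  case False
  define p q where "p = (1 / infnorm u) *\<^sub>R u" and "q = (1 / infnorm v) *\<^sub>R v"
  have pos: "infnorm u > 0" "infnorm v > 0"
    using False by (auto simp: infnorm_pos_lt)
  then have "infnorm p \<le> 1" "infnorm q \<le> 1"
    by (auto simp: p_def q_def infnorm_mul)
  then have "infnorm (h p q) \<le> ?sup"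
    using cSUP_upper[OF _ bdd_above_infnorm_bilinear_unit_balls[OF h_bilinear], of "(p, q)"] by simp
  moreover have "h u v = (infnorm u * infnorm v) *\<^sub>R h p q"
    using pos by (simp add: p_def q_def bilinear_lmul[OF h_bilinear] bilinear_rmul[OF h_bilinear])
  ultimately show ?thesis
    using pos by (simp add: infnorm_mul mult.commute mult_left_mono)
qed

lemma bilinear_D2:
  assumes "Jac f differentiable (at z)"
  shows "bilinear (D2 f z)"
proof -
  have "linear (frechet_derivative (Jac f) (at z))"
    using assms by (rule linear_frechet_derivative)
  then show ?thesis
    unfolding bilinear_def D2_def
    by (auto intro!: linearI simp: linear_add linear_scale matrix_vector_mult_add_rdistrib
        matrix_vector_right_distrib scaleR_matrix_vector_assoc matrix_vector_mult_scaleR)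
qed

lemma infnorm_D2_le:
  assumes "Jac f differentiable (at z)"
  shows "infnorm (D2 f z u v) \<le> d2_norm f z * infnorm u * infnorm v"
  using infnorm_bilinear_le_SUP[OF bilinear_D2[OF assms]]
  unfolding d2_norm_def mnorm_eq_infnorm .

lemma d2_norm_nonneg:
  assumes "Jac f differentiable (at z)"
  shows "0 \<le> d2_norm f z"
proof -
  have "infnorm (vec 1 :: real^'a) = 1"
    by (simp add: mnorm_eq_infnorm[symmetric] mnorm_def)
  then show ?thesis
    using order_trans[OF infnorm_pos_le infnorm_D2_le[OF assms, of "vec 1" "vec 1"]] by simp
qed

lemma has_derivative_Jac:
  "f differentiable (at z) \<Longrightarrow> (f has_derivative (\<lambda>h. Jac f z *v h)) (at z within S)"
  using jacobian_works[of f "at z"] unfolding Jac_def[of f z] jacobian_def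
  by (blast intro: has_derivative_at_withinI)

lemma infnorm_lipschitz_on_mat_norm_Jac:
  assumes "convex S" "0 \<le> L"
    and "\<And>z. z \<in> S \<Longrightarrow> f differentiable (at z)"
    and "\<And>z. z \<in> S \<Longrightarrow> mat_norm (Jac f z) \<le> L"
  shows "infnorm_lipschitz_on L S f"
proof (rule infnorm_lipschitz_on_derivative_bound[OF assms(1,2) has_derivative_Jac])
  fix z h assume "z \<in> S"
  then show "infnorm (Jac f z *v h) \<le> L * infnorm h"
    by (intro order_trans[OF infnorm_matrix_vector_mult_le] mult_right_mono assms infnorm_pos_le)
qed (rule assms)

lemma infnorm_Jac_diff_mult_le:
  fixes f :: "real^'n \<Rightarrow> real^'n"
  assumes convex_mem: "convex S" "p \<in> S" "q \<in> S"
    and Jac_differentiable: "\<And>z. z \<in> S \<Longrightarrow> Jac f differentiable (at z)"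
    and d2_norm_le: "\<And>z. z \<in> S \<Longrightarrow> d2_norm f z \<le> H"
  shows "infnorm ((Jac f p - Jac f q) *v u) \<le> H * infnorm (p - q) * infnorm u"
proof -
  have mult_u: "bounded_linear (\<lambda>M :: real^'n^'n. M *v u)"
    by (intro linear_conv_bounded_linear[THEN iffD1] linearI)
      (simp_all add: matrix_vector_mult_add_rdistrib scaleR_matrix_vector_assoc)
  have "infnorm (Jac f p *v u - Jac f q *v u) \<le> H * infnorm (p - q) * infnorm u"
  proof (rule infnorm_mean_value_le[OF convex_mem])
    fix z assume z_mem: "z \<in> S"
    show "((\<lambda>z. Jac f z *v u) has_derivative (\<lambda>r. D2 f z r u)) (at z within S)"
      unfolding D2_def
      using bounded_linear.has_derivative[OF mult_u
          frechet_derivative_works[THEN iffD1, OF Jac_differentiable[OF z_mem]]]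
      by (rule has_derivative_at_withinI)
    show "infnorm (D2 f z (p - q) u) \<le> H * infnorm (p - q) * infnorm u"
      by (intro order_trans[OF infnorm_D2_le[OF Jac_differentiable[OF z_mem]]] mult_right_mono d2_norm_le
          z_mem infnorm_pos_le)
  qed
  then show ?thesis by (simp add: matrix_vector_mult_diff_rdistrib)
qed

definition lie_deriv :: "(real^'n \<Rightarrow> real^'n) \<Rightarrow> (real^'n \<Rightarrow> real^'n) \<Rightarrow> real^'n \<Rightarrow> real^'n" where
  "lie_deriv q f z = Jac f z *v q z"

lemma infnorm_lipschitz_on_lie_deriv:
  assumes S_convex: "convex S" and "0 \<le> H" "0 \<le> L\<^sub>f" "0 \<le> K\<^sub>q"
    and Jac_f_differentiable: "\<And>z. z \<in> S \<Longrightarrow> Jac f differentiable (at z)"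
    and d2_norm_f_le: "\<And>z. z \<in> S \<Longrightarrow> d2_norm f z \<le> H"
    and mat_norm_Jac_f_le: "\<And>z. z \<in> S \<Longrightarrow> mat_norm (Jac f z) \<le> L\<^sub>f"
    and q_lipschitz: "infnorm_lipschitz_on L\<^sub>q S q" and q_le: "\<And>z. z \<in> S \<Longrightarrow> infnorm (q z) \<le> K\<^sub>q"
  shows "infnorm_lipschitz_on (H * K\<^sub>q + L\<^sub>f * L\<^sub>q) S (lie_deriv q f)"
  unfolding infnorm_lipschitz_on_def
proof (intro conjI ballI)
  show "0 \<le> H * K\<^sub>q + L\<^sub>f * L\<^sub>q"
    using assms(2-4) infnorm_lipschitz_on_nonneg[OF q_lipschitz] by simp
  fix r s assume mem: "r \<in> S" "s \<in> S"
  have "lie_deriv q f r - lie_deriv q f s = (Jac f r - Jac f s) *v q r + Jac f s *v (q r - q s)"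
    by (simp add: lie_deriv_def matrix_vector_mult_diff_rdistrib matrix_vector_mult_diff_distrib)
  then have "infnorm (lie_deriv q f r - lie_deriv q f s)
      \<le> infnorm ((Jac f r - Jac f s) *v q r) + infnorm (Jac f s *v (q r - q s))"
    by (simp only: infnorm_triangle)
  also have "infnorm ((Jac f r - Jac f s) *v q r) \<le> H * infnorm (r - s) * K\<^sub>q"
    using \<open>0 \<le> H\<close>
    by (intro order_trans[OF infnorm_Jac_diff_mult_le[OF S_convex mem Jac_f_differentiable d2_norm_f_le]]
        mult_left_mono q_le mem
        mult_nonneg_nonneg infnorm_pos_le)
  also have "infnorm (Jac f s *v (q r - q s)) \<le> L\<^sub>f * (L\<^sub>q * infnorm (r - s))"
    using \<open>0 \<le> L\<^sub>f\<close>
    by (intro order_trans[OF infnorm_matrix_vector_mult_le] mult_mono mat_norm_Jac_f_le mem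
        infnorm_lipschitz_onD[OF q_lipschitz] infnorm_pos_le)
  finally show "infnorm (lie_deriv q f r - lie_deriv q f s) \<le> (H * K\<^sub>q + L\<^sub>f * L\<^sub>q) * infnorm (r - s)"
    by (simp add: algebra_simps)
qed

lemma infnorm_euler_step_diff_le:
  assumes convex_mem: "convex S" "p \<in> S" "q \<in> S"
    and f_differentiable: "\<And>z. z \<in> S \<Longrightarrow> f differentiable (at z)"
    and mat_norm_le: "\<And>z. z \<in> S \<Longrightarrow> mat_norm (Jac f z) \<le> L"
    and log_norm_le: "\<And>z. z \<in> S \<Longrightarrow> log_norm (Jac f z) \<le> \<Lambda>"
    and \<delta>_bounds: "0 \<le> \<delta>" "\<delta> * L \<le> 1"
  shows "infnorm ((p + \<delta> *\<^sub>R f p) - (q + \<delta> *\<^sub>R f q)) \<le> (1 + \<delta> * \<Lambda>) * infnorm (p - q)"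
proof (rule infnorm_mean_value_le[OF convex_mem])
  fix z assume z_mem: "z \<in> S"
  show "((\<lambda>z. z + \<delta> *\<^sub>R f z) has_derivative (\<lambda>h. h + \<delta> *\<^sub>R (Jac f z *v h))) (at z within S)"
    by (intro derivative_intros has_derivative_Jac f_differentiable z_mem)
  have "\<delta> * mat_norm (Jac f z) \<le> 1"
    using mult_left_mono[OF mat_norm_le[OF z_mem] \<delta>_bounds(1)] \<delta>_bounds(2) by linarith
  then have "infnorm ((p - q) + \<delta> *\<^sub>R (Jac f z *v (p - q))) \<le> (1 + \<delta> * log_norm (Jac f z)) * infnorm (p - q)"
    by (intro infnorm_euler_step_le_log_norm \<delta>_bounds)
  also have "\<dots> \<le> (1 + \<delta> * \<Lambda>) * infnorm (p - q)"
    by (intro mult_right_mono add_left_mono mult_left_mono log_norm_le z_mem \<delta>_bounds infnorm_pos_le)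
  finally show "infnorm ((p - q) + \<delta> *\<^sub>R (Jac f z *v (p - q))) \<le> (1 + \<delta> * \<Lambda>) * infnorm (p - q)" .
qed

subsection \<open>Integral estimates\<close>

lemma infnorm_has_integral_le:
  fixes F :: "'n::euclidean_space \<Rightarrow> 'a::euclidean_space"
  assumes F_integral: "(F has_integral I) S" and \<phi>_integral: "(\<phi> has_integral J) S"
    and F_le: "\<And>t. t \<in> S \<Longrightarrow> infnorm (F t) \<le> \<phi> t"
  shows "infnorm I \<le> J"
proof (rule infnorm_leI)
  fix i :: 'a assume i_Basis: "i \<in> Basis"
  have component_integral: "((\<lambda>t. F t \<bullet> i) has_integral I \<bullet> i) S"
    using has_integral_linear[OF F_integral bounded_linear_inner_left[of i]] by (simp add: o_def)
  have "\<bar>F t \<bullet> i\<bar> \<le> \<phi> t" if "t \<in> S" for t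
    using Basis_le_infnorm[OF i_Basis] F_le[OF that] by (rule order_trans)
  then have "I \<bullet> i \<le> J" "- (I \<bullet> i) \<le> J"
    using has_integral_le[OF component_integral \<phi>_integral]
        has_integral_le[OF has_integral_neg[OF component_integral] \<phi>_integral]
    by (simp_all add: abs_le_iff)
  then show "\<bar>I \<bullet> i\<bar> \<le> J" by simp
qed

lemma infnorm_has_integral_const_le:
  fixes F :: "real \<Rightarrow> 'a::euclidean_space"
  assumes "(F has_integral I) {s..t}" "s \<le> t" "\<And>\<tau>. \<tau> \<in> {s..t} \<Longrightarrow> infnorm (F \<tau>) \<le> C"
  shows "infnorm I \<le> C * (t - s)"
  using infnorm_has_integral_le[OF assms(1) has_integral_const_real assms(3)] assms(2)
  by (simp add: mult.commute)

lemma bounded_measurable_scaleR_continuous_integrable: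
  fixes u :: "real \<Rightarrow> real" and \<phi> :: "real \<Rightarrow> 'a::euclidean_space"
  assumes "u \<in> borel_measurable (lebesgue_on {a..b})" and u_le: "\<And>t. t \<in> {a..b} \<Longrightarrow> \<bar>u t\<bar> \<le> U"
    and "continuous_on {a..b} \<phi>"
  shows "(\<lambda>t. u t *\<^sub>R \<phi> t) integrable_on {a..b}"
proof -
  have "bounded (u ` {a..b})"
    unfolding bounded_iff using u_le by (intro exI[of _ U]) auto
  then have "(\<lambda>t. u t *\<^sub>R \<phi> t) absolutely_integrable_on {a..b}"
    by (intro absolutely_integrable_bounded_measurable_product[where h = scaleR]
        absolutely_integrable_continuous_real assms)
      (simp_all add: bilinear_conv_bounded_bilinear bounded_bilinear_scaleR)
  then show ?thesis
    by (rule set_lebesgue_integral_eq_integral(1))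
qed

lemma bounded_measurable_square_integrable:
  fixes u :: "real \<Rightarrow> real"
  assumes u_bounded_measurable: "u \<in> borel_measurable (lebesgue_on {a..b})" "\<And>t. t \<in> {a..b} \<Longrightarrow> \<bar>u t\<bar> \<le> U"
  shows "(\<lambda>t. (u t)\<^sup>2) integrable_on {a..b}"
proof (rule measurable_bounded_by_integrable_imp_integrable)
  show "(\<lambda>t. (u t)\<^sup>2) \<in> borel_measurable (lebesgue_on {a..b})"
    using u_bounded_measurable(1) by (intro borel_measurable_power)
  show "norm ((u t)\<^sup>2) \<le> U\<^sup>2" if "t \<in> {a..b}" for t
    using power_mono[OF u_bounded_measurable(2)[OF that], of 2] by simp
qed auto

lemma has_integral_shifted_power:
  fixes a b c :: real
  assumes "a \<le> b"
  shows "((\<lambda>t. (t - c) ^ n) has_integral ((b - c) ^ Suc n - (a - c) ^ Suc n) / (n + 1)) {a..b}"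
proof -
  have "((\<lambda>t. (t - c) ^ n) has_integral (b - c) ^ Suc n / (n + 1) - (a - c) ^ Suc n / (n + 1)) {a..b}"
    using assms
    by (intro fundamental_theorem_of_calculus)
      (auto intro!: derivative_eq_intros simp: has_real_derivative_iff_has_vector_derivative[symmetric]
        simp del: power_Suc)
  then show ?thesis by (simp add: diff_divide_distrib)
qed

lemma has_integral_abs_shifted:
  fixes a b c :: real
  assumes "a \<le> c" "c \<le> b"
  shows "((\<lambda>t. \<bar>t - c\<bar>) has_integral ((c - a)\<^sup>2 + (b - c)\<^sup>2) / 2) {a..b}"
proof -
  have "((\<lambda>t. \<bar>t - c\<bar>) has_integral (c - a)\<^sup>2 / 2) {a..c}"
    by (rule has_integral_eq[rotated,
          OF has_integral_eq_rhs[OF has_integral_neg[OF has_integral_shifted_power[OF assms(1), of c 1]]]])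
      (simp_all add: power2_eq_square field_simps)
  moreover have "((\<lambda>t. \<bar>t - c\<bar>) has_integral (b - c)\<^sup>2 / 2) {c..b}"
    by (rule has_integral_eq[rotated,
          OF has_integral_eq_rhs[OF has_integral_shifted_power[OF assms(2), of c 1]]])
      (simp_all add: power2_eq_square)
  ultimately have "((\<lambda>t. \<bar>t - c\<bar>) has_integral ((c - a)\<^sup>2 / 2 + (b - c)\<^sup>2 / 2)) {a..b}"
    using assms by (intro has_integral_combine)
  then show ?thesis by (simp add: add_divide_distrib)
qed

lemma integral_abs_midpoint:
  fixes a b :: real
  assumes "a \<le> b"
  shows "integral {a..b} (\<lambda>t. \<bar>t - (a + b) / 2\<bar>) = (b - a)\<^sup>2 / 4"
proof -
  let ?c = "(a + b) / 2"
  have "integral {a..b} (\<lambda>t. \<bar>t - ?c\<bar>) = ((?c - a)\<^sup>2 + (b - ?c)\<^sup>2) / 2"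
    using assms by (intro integral_unique has_integral_abs_shifted) auto
  then show ?thesis by (simp add: field_simps power2_eq_square)
qed

lemma integral_linear:
  fixes a b :: real
  assumes "a \<le> b"
  shows "integral {a..b} (\<lambda>t. t - a) = (b - a)\<^sup>2 / 2"
  using has_integral_shifted_power[OF assms, of a 1] by (simp add: integral_unique power2_eq_square)

lemma integral_midpoint_power4:
  fixes a b :: real
  assumes "a \<le> b"
  shows "integral {a..b} (\<lambda>t. (t - (a + b) / 2) ^ 4) = (b - a) ^ 5 / 80"
proof -
  let ?c = "(a + b) / 2"
  have half: "b - ?c = (b - a) / 2" "a - ?c = - ((b - a) / 2)"
    by (simp_all add: field_simps)
  have "integral {a..b} (\<lambda>t. (t - ?c) ^ 4) = ((b - ?c) ^ 5 - (a - ?c) ^ 5) / 5"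
    using has_integral_shifted_power[OF assms, of ?c 4] by (simp add: integral_unique eval_nat_numeral)
  then show ?thesis
    unfolding half by (simp add: power_divide)
qed

lemma integral_Cauchy_Schwarz:
  fixes f g :: "'a::euclidean_space \<Rightarrow> real"
  assumes f_square: "(\<lambda>x. (f x)\<^sup>2) integrable_on S" and g_square: "(\<lambda>x. (g x)\<^sup>2) integrable_on S"
    and product: "(\<lambda>x. f x * g x) integrable_on S"
  shows "(integral S (\<lambda>x. f x * g x))\<^sup>2 \<le> integral S (\<lambda>x. (f x)\<^sup>2) * integral S (\<lambda>x. (g x)\<^sup>2)"
proof -
  let ?A = "integral S (\<lambda>x. (f x)\<^sup>2)" and ?B = "integral S (\<lambda>x. f x * g x)" and ?C = "integral S (\<lambda>x. (g x)\<^sup>2)"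
  have form_nonneg: "0 \<le> r\<^sup>2 * ?A - 2 * r * s * ?B + s\<^sup>2 * ?C" for r s
  proof (rule has_integral_nonneg)
    have "((\<lambda>x. r\<^sup>2 * (f x)\<^sup>2 - 2 * r * s * (f x * g x) + s\<^sup>2 * (g x)\<^sup>2)
        has_integral r\<^sup>2 * ?A - 2 * r * s * ?B + s\<^sup>2 * ?C) S"
      by (intro has_integral_add has_integral_diff has_integral_mult_right integrable_integral f_square
          g_square product)
    then show "((\<lambda>x. (r * f x - s * g x)\<^sup>2) has_integral r\<^sup>2 * ?A - 2 * r * s * ?B + s\<^sup>2 * ?C) S"
      by (simp add: power2_eq_square algebra_simps)
  qed simp
  show ?thesis
  proof (cases "?C = 0")
    case True
    have "?B = 0"
      using form_nonneg[of 1 "(?A + 1) / (2 * ?B)"] True by (cases "?B = 0") simp_all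
    with True show ?thesis by simp
  next
    case False
    then have "0 < ?C"
      using form_nonneg[of 0 1] by simp
    moreover have "0 \<le> ?C * (?A * ?C - ?B\<^sup>2)"
      using form_nonneg[of ?C ?B] by (simp add: power2_eq_square algebra_simps)
    ultimately show ?thesis
      by (simp add: zero_le_mult_iff)
  qed
qed

lemma integral_square_add_orthogonal:
  fixes f g :: "'a::euclidean_space \<Rightarrow> real"
  assumes f_square: "(\<lambda>x. (f x)\<^sup>2) integrable_on S" and g_square: "(\<lambda>x. (g x)\<^sup>2) integrable_on S"
    and orthogonal: "((\<lambda>x. f x * g x) has_integral 0) S"
  shows "integral S (\<lambda>x. (f x + g x)\<^sup>2) = integral S (\<lambda>x. (f x)\<^sup>2) + integral S (\<lambda>x. (g x)\<^sup>2)"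
proof (rule integral_unique)
  have "((\<lambda>x. (f x)\<^sup>2 + 2 * (f x * g x) + (g x)\<^sup>2)
      has_integral integral S (\<lambda>x. (f x)\<^sup>2) + 2 * 0 + integral S (\<lambda>x. (g x)\<^sup>2)) S"
    by (intro has_integral_add has_integral_mult_right orthogonal integrable_integral f_square g_square)
  then show "((\<lambda>x. (f x + g x)\<^sup>2) has_integral integral S (\<lambda>x. (f x)\<^sup>2) + integral S (\<lambda>x. (g x)\<^sup>2)) S"
    by (simp add: power2_sum algebra_simps)
qed

subsection \<open>Affine functions with matching moments\<close>

lemma has_integral_affine_mult_zero:
  fixes d :: "real \<Rightarrow> real"
  assumes "(d has_integral 0) S" "((\<lambda>t. (t - c) * d t) has_integral 0) S"
  shows "((\<lambda>t. d t * (p + q * t)) has_integral 0) S"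
proof -
  have "((\<lambda>t. (p + q * c) * d t + q * ((t - c) * d t)) has_integral (p + q * c) * 0 + q * 0) S"
    by (intro has_integral_add has_integral_mult_right assms)
  then show ?thesis by (simp add: algebra_simps)
qed

lemma has_integral_centered_affine_square:
  fixes a b p q :: real
  assumes "a \<le> b"
  shows "((\<lambda>t. (p + q * (t - (a + b) / 2))\<^sup>2) has_integral (p\<^sup>2 + q\<^sup>2 * (b - a)\<^sup>2 / 12) * (b - a)) {a..b}"
proof -
  let ?c = "(a + b) / 2"
  have "((\<lambda>t. p\<^sup>2 + (2 * p * q) * (t - ?c) ^ 1 + q\<^sup>2 * (t - ?c)\<^sup>2)
      has_integral (p\<^sup>2 + q\<^sup>2 * (b - a)\<^sup>2 / 12) * (b - a)) {a..b}"
    by (rule has_integral_eq_rhs[OF has_integral_add[OF has_integral_add[OF has_integral_const_real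
              has_integral_mult_right[OF has_integral_shifted_power[OF assms]]]
            has_integral_mult_right[OF has_integral_shifted_power[OF assms]]]])
      (use assms in \<open>simp add: field_simps power2_eq_square power3_eq_cube numeral_3_eq_3\<close>)
  then show ?thesis
    by (simp add: power2_sum power_mult_distrib mult_ac add_ac)
qed

lemma affine_square_le_integral:
  fixes p q :: real
  assumes t_mem: "t \<in> {a..b}"
  shows "(p + q * t)\<^sup>2 * (b - a) \<le> 4 * integral {a..b} (\<lambda>t. (p + q * t)\<^sup>2)"
proof -
  define c \<alpha> r where "c = (a + b) / 2" and "\<alpha> = p + q * c" and "r = q * (t - c)"
  have "\<bar>t - c\<bar> \<le> \<bar>(b - a) / 2\<bar>"
    using t_mem by (auto simp: c_def abs_if field_simps)
  then have "(t - c)\<^sup>2 \<le> ((b - a) / 2)\<^sup>2"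
    by (rule abs_le_square_iff[THEN iffD1])
  then have "q\<^sup>2 * (t - c)\<^sup>2 \<le> q\<^sup>2 * ((b - a) / 2)\<^sup>2"
    by (intro mult_left_mono) auto
  then have r_square_le: "r\<^sup>2 / 3 \<le> q\<^sup>2 * (b - a)\<^sup>2 / 12"
    by (simp add: r_def power_mult_distrib power_divide)
  have affine: "\<alpha> + q * (s - c) = p + q * s" for s
    by (simp add: \<alpha>_def algebra_simps)
  then have "p + q * t = \<alpha> + r"
    by (simp add: r_def)
  moreover have "(\<alpha> + r)\<^sup>2 \<le> 4 * (\<alpha>\<^sup>2 + r\<^sup>2 / 3)"
    using zero_le_power2[of "3 * \<alpha> - r"] by (simp add: power2_eq_square algebra_simps)
  ultimately have "(p + q * t)\<^sup>2 \<le> 4 * (\<alpha>\<^sup>2 + q\<^sup>2 * (b - a)\<^sup>2 / 12)"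
    using r_square_le by simp
  then have "(p + q * t)\<^sup>2 * (b - a) \<le> 4 * (\<alpha>\<^sup>2 + q\<^sup>2 * (b - a)\<^sup>2 / 12) * (b - a)"
    by (rule mult_right_mono) (use t_mem in simp)
  also have "\<dots> = 4 * integral {a..b} (\<lambda>t. (p + q * t)\<^sup>2)"
    using has_integral_centered_affine_square[of a b \<alpha> q] t_mem
    by (simp add: affine c_def[symmetric] integral_unique)
  finally show ?thesis .
qed

lemma affine_imp_continuous_on:
  fixes w :: "real \<Rightarrow> real"
  assumes "\<exists>p q. \<forall>t\<in>S. w t = p + q * t"
  shows "continuous_on S w"
proof -
  obtain p q where "\<And>t. t \<in> S \<Longrightarrow> w t = p + q * t"
    using assms by blast
  then show ?thesis
    by (subst continuous_on_cong[OF refl, of _ _ "\<lambda>t. p + q * t"]) (auto intro!: continuous_intros)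
qed

lemma affine_projection_pythagoras:
  fixes v w :: "real \<Rightarrow> real"
  assumes v_measurable: "v \<in> borel_measurable (lebesgue_on {a..b})"
    and v_le: "\<And>t. t \<in> {a..b} \<Longrightarrow> \<bar>v t\<bar> \<le> V"
    and affine: "\<exists>p q. \<forall>t\<in>{a..b}. w t = p + q * t"
    and mean: "integral {a..b} (\<lambda>t. v t - w t) = 0"
    and moment: "integral {a..b} (\<lambda>t. (t - c) * (v t - w t)) = 0"
  shows "integral {a..b} (\<lambda>t. (v t)\<^sup>2) = integral {a..b} (\<lambda>t. (v t - w t)\<^sup>2) + integral {a..b} (\<lambda>t. (w t)\<^sup>2)"
proof -
  note w_continuous = affine_imp_continuous_on[OF affine]
  obtain p q where w_eq: "\<And>t. t \<in> {a..b} \<Longrightarrow> w t = p + q * t"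
    using affine by blast
  have v_mult: "(\<lambda>t. v t * r t) integrable_on {a..b}" if "continuous_on {a..b} r" for r
    using bounded_measurable_scaleR_continuous_integrable[OF v_measurable v_le that] by simp
  have diff_mult: "(\<lambda>t. r t * (v t - w t)) integrable_on {a..b}" if "continuous_on {a..b} r" for r
    using integrable_diff[OF v_mult[OF that]
        integrable_continuous_real[OF continuous_on_mult[OF w_continuous that]]]
    by (simp add: algebra_simps)
  have w_square: "(\<lambda>t. (w t)\<^sup>2) integrable_on {a..b}"
    by (intro integrable_continuous_real continuous_intros w_continuous)
  have diff_square: "(\<lambda>t. (v t - w t)\<^sup>2) integrable_on {a..b}"
    using integrable_diff[OF integrable_add[OF bounded_measurable_square_integrable[OF v_measurable v_le] w_square]
        integrable_on_mult_right[OF v_mult[OF w_continuous], of 2]]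
    by (simp add: power2_diff mult.assoc)
  have "((\<lambda>t. (v t - w t) * (p + q * t)) has_integral 0) {a..b}"
    using mean moment diff_mult[of "\<lambda>_. 1"] diff_mult[of "\<lambda>t. t - c"]
    by (intro has_integral_affine_mult_zero) (simp_all add: has_integral_iff continuous_intros)
  then have "((\<lambda>t. (v t - w t) * w t) has_integral 0) {a..b}"
    by (rule has_integral_eq[rotated]) (simp add: w_eq)
  from integral_square_add_orthogonal[OF diff_square w_square this] show ?thesis
    by simp
qed

lemma affine_projection_integral_square_le:
  fixes v w :: "real \<Rightarrow> real"
  assumes v_measurable: "v \<in> borel_measurable (lebesgue_on {a..b})"
    and v_le: "\<And>t. t \<in> {a..b} \<Longrightarrow> \<bar>v t\<bar> \<le> V" and "a \<le> b"
    and affine: "\<exists>p q. \<forall>t\<in>{a..b}. w t = p + q * t"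
    and mean: "integral {a..b} (\<lambda>t. v t - w t) = 0"
    and moment: "integral {a..b} (\<lambda>t. (t - c) * (v t - w t)) = 0"
  shows "integral {a..b} (\<lambda>t. (w t)\<^sup>2) \<le> V\<^sup>2 * (b - a)"
    and "integral {a..b} (\<lambda>t. (v t - w t)\<^sup>2) \<le> V\<^sup>2 * (b - a)"
proof -
  have "integral {a..b} (\<lambda>t. (v t)\<^sup>2) \<le> integral {a..b} (\<lambda>t. V\<^sup>2)"
    using power_mono[OF v_le, of _ 2]
    by (intro integral_le bounded_measurable_square_integrable[OF v_measurable v_le]) auto
  then have "integral {a..b} (\<lambda>t. (v t)\<^sup>2) \<le> V\<^sup>2 * (b - a)"
    using \<open>a \<le> b\<close> by (simp add: mult.commute)
  moreover have "0 \<le> integral {a..b} (\<lambda>t. (v t - w t)\<^sup>2)" "0 \<le> integral {a..b} (\<lambda>t. (w t)\<^sup>2)"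
    by (rule integral_component_nonneg[of "1 :: real", simplified]; simp)+
  ultimately show "integral {a..b} (\<lambda>t. (w t)\<^sup>2) \<le> V\<^sup>2 * (b - a)"
    and "integral {a..b} (\<lambda>t. (v t - w t)\<^sup>2) \<le> V\<^sup>2 * (b - a)"
    using affine_projection_pythagoras[OF v_measurable v_le affine mean moment] by linarith+
qed

lemma affine_projection_abs_le:
  fixes v w :: "real \<Rightarrow> real"
  assumes v_measurable: "v \<in> borel_measurable (lebesgue_on {a..b})"
    and v_le: "\<And>t. t \<in> {a..b} \<Longrightarrow> \<bar>v t\<bar> \<le> V" and "a < b"
    and affine: "\<exists>p q. \<forall>t\<in>{a..b}. w t = p + q * t"
    and mean: "integral {a..b} (\<lambda>t. v t - w t) = 0"
    and moment: "integral {a..b} (\<lambda>t. (t - c) * (v t - w t)) = 0"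
    and t_mem: "t \<in> {a..b}"
  shows "\<bar>w t\<bar> \<le> 2 * V"
proof -
  obtain p q where w_eq: "\<And>t. t \<in> {a..b} \<Longrightarrow> w t = p + q * t"
    using affine by blast
  have "(w t)\<^sup>2 * (b - a) \<le> 4 * integral {a..b} (\<lambda>t. (p + q * t)\<^sup>2)"
    unfolding w_eq[OF t_mem] by (rule affine_square_le_integral[OF t_mem])
  also have "integral {a..b} (\<lambda>t. (p + q * t)\<^sup>2) = integral {a..b} (\<lambda>t. (w t)\<^sup>2)"
    by (rule integral_cong) (simp add: w_eq)
  also have "4 * \<dots> \<le> 4 * (V\<^sup>2 * (b - a))"
    using affine_projection_integral_square_le(1)[OF v_measurable v_le less_imp_le[OF \<open>a < b\<close>] affine mean moment]
    by simp
  finally have "(w t)\<^sup>2 * (b - a) \<le> (2 * V)\<^sup>2 * (b - a)"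
    by (simp add: power_mult_distrib)
  then have "(w t)\<^sup>2 \<le> (2 * V)\<^sup>2"
    using \<open>a < b\<close> by simp
  then have "\<bar>w t\<bar> \<le> \<bar>2 * V\<bar>"
    by (rule abs_le_square_iff[THEN iffD2])
  moreover have "0 \<le> V"
    using v_le[OF t_mem] by linarith
  ultimately show ?thesis by simp
qed

subsection \<open>Chain rule for indefinite integrals\<close>

lemma indefinite_integral_subinterval:
  fixes F z :: "real \<Rightarrow> 'a::banach"
  assumes z_integral: "\<And>t. t \<in> {a..b} \<Longrightarrow> (F has_integral (z t - z a)) {a..t}"
    and order: "a \<le> s" "s \<le> t" "t \<le> b"
  shows "(F has_integral (z t - z s)) {s..t}"
proof -
  have integral_to_t: "(F has_integral (z t - z a)) {a..t}" and integral_to_s: "(F has_integral (z s - z a)) {a..s}"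
    using z_integral[of t] z_integral[of s] order by simp_all
  have "F integrable_on {s..t}"
    by (rule integrable_subinterval_real[OF has_integral_integrable[OF integral_to_t]]) (use order in simp)
  then obtain I where I_integral: "(F has_integral I) {s..t}" by blast
  have "(F has_integral (z s - z a + I)) {a..t}"
    by (rule has_integral_combine[OF order(1,2) integral_to_s I_integral])
  with integral_to_t have "z t - z a = z s - z a + I"
    by (rule has_integral_unique)
  with I_integral show ?thesis by (simp add: algebra_simps)
qed

lemma indefinite_integral_lipschitz_on:
  fixes F z :: "real \<Rightarrow> 'a::euclidean_space"
  assumes a_le_b: "a \<le> b" and z_integral: "\<And>t. t \<in> {a..b} \<Longrightarrow> (F has_integral (z t - z a)) {a..t}"
    and F_le: "\<And>t. t \<in> {a..b} \<Longrightarrow> norm (F t) \<le> M"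
  shows "M-lipschitz_on {a..b} z"
proof (rule lipschitz_on_leI)
  show "0 \<le> M" using F_le[of a] a_le_b norm_ge_zero[of "F a"] by (simp del: norm_ge_zero)
  fix s t assume mem: "s \<in> {a..b}" "t \<in> {a..b}" "s \<le> t"
  then have "norm (z t - z s) \<le> M * (t - s)"
    using has_integral_bound_real[OF \<open>0 \<le> M\<close> finite.emptyI indefinite_integral_subinterval[OF z_integral]]
        F_le by auto
  with mem show "dist (z s) (z t) \<le> M * dist s t"
    by (simp add: dist_norm norm_minus_commute)
qed

lemma has_derivative_zero_compose_lipschitz:
  fixes x :: "'c::real_normed_vector \<Rightarrow> 'a::real_normed_vector" and r :: "'a \<Rightarrow> 'b::real_normed_vector"
  assumes r_derivative: "(r has_derivative (\<lambda>_. 0)) (at (x t))"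
    and x_lipschitz: "C-lipschitz_on S x" and t_mem: "t \<in> S"
  shows "((\<lambda>\<tau>. r (x \<tau>)) has_derivative (\<lambda>_. 0)) (at t within S)"
  unfolding has_derivative_within_alt2
proof (intro conjI allI impI)
  fix e :: real assume "e > 0"
  have C_nonneg: "0 \<le> C" by (rule lipschitz_on_nonneg[OF x_lipschitz])
  define e' where "e' = e / (C + 1)"
  have e'_bounds: "e' > 0" "e' * C \<le> e"
    using \<open>e > 0\<close> C_nonneg by (auto simp: e'_def field_simps)
  have "\<forall>\<^sub>F y in at (x t). norm (r y - r (x t)) \<le> e' * norm (y - x t)"
    using r_derivative e'_bounds(1) unfolding has_derivative_within_alt2 by simp
  then have "\<forall>\<^sub>F y in nhds (x t). norm (r y - r (x t)) \<le> e' * norm (y - x t)"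
    by (simp add: eventually_nhds_conv_at)
  moreover have "(x \<longlongrightarrow> x t) (at t within S)"
    using lipschitz_on_continuous_on[OF x_lipschitz] t_mem by (simp add: continuous_on_def)
  ultimately have "\<forall>\<^sub>F \<tau> in at t within S. norm (r (x \<tau>) - r (x t)) \<le> e' * norm (x \<tau> - x t)"
    by (rule eventually_compose_filterlim)
  moreover have "\<forall>\<^sub>F \<tau> in at t within S. \<tau> \<in> S"
    by (simp add: eventually_at_filter)
  ultimately show "\<forall>\<^sub>F \<tau> in at t within S. norm (r (x \<tau>) - r (x t) - 0) \<le> e * norm (\<tau> - t)"
  proof eventually_elim
    case (elim \<tau>)
    have "norm (r (x \<tau>) - r (x t)) \<le> e' * (C * norm (\<tau> - t))"
      using elim(1) mult_left_mono[OF lipschitz_on_normD[OF x_lipschitz elim(2) t_mem]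
          less_imp_le[OF e'_bounds(1)]] by linarith
    also have "\<dots> \<le> e * norm (\<tau> - t)"
      using e'_bounds(2) by (simp add: mult.assoc[symmetric] mult_right_mono)
    finally show ?case by simp
  qed
qed simp

lemma indefinite_integral_has_derivative_zero:
  fixes prod :: "'c::euclidean_space \<Rightarrow> 'a::euclidean_space \<Rightarrow> 'b::euclidean_space" and F :: "real \<Rightarrow> 'a"
  assumes prod_bilinear: "bilinear prod"
    and integrable: "(\<lambda>\<sigma>. prod (C \<sigma>) (F \<sigma>)) integrable_on {a..b}"
    and C_vanishes: "continuous (at t within {a..b}) C" "C t = 0"
    and F_le: "\<And>\<sigma>. \<sigma> \<in> {a..b} \<Longrightarrow> norm (F \<sigma>) \<le> M" and t_mem: "t \<in> {a..b}"
  shows "((\<lambda>\<tau>. integral {a..\<tau>} (\<lambda>\<sigma>. prod (C \<sigma>) (F \<sigma>))) has_derivative (\<lambda>_. 0)) (at t within {a..b})"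
proof -
  obtain N where N_bound: "N > 0" "\<And>u v. norm (prod u v) \<le> N * norm u * norm v"
    using bilinear_bounded_pos[OF prod_bilinear] by blast
  have "((\<lambda>\<sigma>. norm (C \<sigma>)) \<longlongrightarrow> 0) (at t within {a..b})"
    using C_vanishes by (simp add: continuous_within tendsto_norm_zero)
  then have "((\<lambda>\<sigma>. prod (C \<sigma>) (F \<sigma>)) \<longlongrightarrow> 0) (at t within {a..b})"
  proof (rule tendsto_0_le)
    have "norm (prod (C \<sigma>) (F \<sigma>)) \<le> norm (norm (C \<sigma>)) * (N * M)" if "\<sigma> \<in> {a..b}" for \<sigma>
    proof -
      have "norm (prod (C \<sigma>) (F \<sigma>)) \<le> N * norm (C \<sigma>) * norm (F \<sigma>)"
        by (rule N_bound(2))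
      also have "\<dots> \<le> N * norm (C \<sigma>) * M"
        using N_bound(1) by (intro mult_left_mono F_le that) simp
      finally show ?thesis by (simp add: mult_ac)
    qed
    then show "\<forall>\<^sub>F \<sigma> in at t within {a..b}. norm (prod (C \<sigma>) (F \<sigma>)) \<le> norm (norm (C \<sigma>)) * (N * M)"
      by (simp add: eventually_at_filter)
  qed
  then have "continuous (at t within {a..b} - {}) (\<lambda>\<sigma>. prod (C \<sigma>) (F \<sigma>))"
    using C_vanishes(2) bilinear_lzero[OF prod_bilinear] by (simp add: continuous_within)
  from integral_has_vector_derivative_continuous_at[OF integrable _ finite.emptyI this] show ?thesis
    using t_mem C_vanishes(2) bilinear_lzero[OF prod_bilinear] by (simp add: has_vector_derivative_def)
qed

lemma bilinear_continuous_bounded_integrable: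
  fixes prod :: "'c::euclidean_space \<Rightarrow> 'a::euclidean_space \<Rightarrow> 'b::euclidean_space" and F :: "real \<Rightarrow> 'a"
  assumes prod_bilinear: "bilinear prod" and C_continuous: "continuous_on {a..b} C"
    and "F integrable_on {a..b}" and F_le: "\<And>t. t \<in> {a..b} \<Longrightarrow> norm (F t) \<le> M"
  shows "(\<lambda>t. prod (C t) (F t)) integrable_on {a..b}"
proof -
  have "F absolutely_integrable_on {a..b}"
    by (rule absolutely_integrable_integrable_bound[OF F_le assms(3)]) auto
  moreover have "C \<in> borel_measurable (lebesgue_on {a..b})"
    by (intro continuous_imp_measurable_on_sets_lebesgue C_continuous) simp
  moreover have "bounded (C ` {a..b})"
    by (intro compact_imp_bounded compact_continuous_image C_continuous compact_Icc)
  ultimately have "(\<lambda>t. prod (C t) (F t)) absolutely_integrable_on {a..b}"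
    by (intro absolutely_integrable_bounded_measurable_product[OF prod_bilinear]) simp_all
  then show ?thesis
    by (rule set_lebesgue_integral_eq_integral(1))
qed

text \<open>A curve that is merely an indefinite integral need not be differentiable at a given point, but its
  first-order increments cancel in the difference of the two sides of the chain rule, which therefore has
  derivative zero \<^emph>\<open>everywhere\<close>.\<close>

lemma chain_rule_defect_has_derivative_zero:
  fixes prod :: "'c::euclidean_space \<Rightarrow> 'a::euclidean_space \<Rightarrow> 'b::euclidean_space" and F z :: "real \<Rightarrow> 'a"
  assumes prod_bilinear: "bilinear prod"
    and z_integral: "\<And>t. t \<in> {a..b} \<Longrightarrow> (F has_integral (z t - z a)) {a..t}"
    and F_le: "\<And>t. t \<in> {a..b} \<Longrightarrow> norm (F t) \<le> M"
    and t_mem: "t \<in> {a..b}" and \<phi>_derivative: "(\<phi> has_derivative prod (D t)) (at (z t))"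
    and D_continuous: "continuous_on {a..b} D"
  shows "((\<lambda>\<tau>. \<phi> (z \<tau>) - integral {a..\<tau>} (\<lambda>\<sigma>. prod (D \<sigma>) (F \<sigma>))) has_derivative (\<lambda>_. 0))
    (at t within {a..b})"
proof -
  have prod_linear: "bounded_linear (prod (D t))"
    using prod_bilinear by (simp add: bilinear_conv_bounded_bilinear bounded_bilinear.bounded_linear_right)
  have "a \<le> b" using t_mem by simp
  have "F integrable_on {a..b}"
    using z_integral[of b] \<open>a \<le> b\<close> by auto
  note prod_integrable = bilinear_continuous_bounded_integrable[OF prod_bilinear _ this F_le]
  have "((\<lambda>p. \<phi> p - prod (D t) p) has_derivative (\<lambda>h. prod (D t) h - prod (D t) h)) (at (z t))"
    by (intro has_derivative_diff \<phi>_derivative bounded_linear_imp_has_derivative prod_linear)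
  then have "((\<lambda>\<tau>. \<phi> (z \<tau>) - prod (D t) (z \<tau>)) has_derivative (\<lambda>_. 0)) (at t within {a..b})"
    using has_derivative_zero_compose_lipschitz[OF _
        indefinite_integral_lipschitz_on[OF \<open>a \<le> b\<close> z_integral F_le] t_mem,
        of "\<lambda>p. \<phi> p - prod (D t) p"] by simp
  moreover have "continuous_on {a..b} (\<lambda>\<sigma>. D \<sigma> - D t)"
    by (intro continuous_intros D_continuous)
  then have "((\<lambda>\<tau>. integral {a..\<tau>} (\<lambda>\<sigma>. prod (D \<sigma> - D t) (F \<sigma>))) has_derivative (\<lambda>_. 0)) (at t within {a..b})"
    using t_mem F_le by (intro indefinite_integral_has_derivative_zero[OF prod_bilinear prod_integrable])
      (auto simp: continuous_on_eq_continuous_within)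
  ultimately have "((\<lambda>\<tau>. (\<phi> (z \<tau>) - prod (D t) (z \<tau>)) - integral {a..\<tau>} (\<lambda>\<sigma>. prod (D \<sigma> - D t) (F \<sigma>))
      + prod (D t) (z a)) has_derivative (\<lambda>_. 0 - 0 + 0)) (at t within {a..b})"
    by (intro has_derivative_add has_derivative_diff has_derivative_const)
  then show ?thesis
  proof (rule has_derivative_transform[OF t_mem, rotated, THEN has_derivative_eq_rhs])
    fix \<tau> assume \<tau>_mem: "\<tau> \<in> {a..b}"
    have "((\<lambda>\<sigma>. prod (D \<sigma> - D t) (F \<sigma>)) has_integral
        integral {a..\<tau>} (\<lambda>\<sigma>. prod (D \<sigma>) (F \<sigma>)) - prod (D t) (z \<tau> - z a)) {a..\<tau>}"
      unfolding bilinear_lsub[OF prod_bilinear]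
      using \<tau>_mem integrable_subinterval_real[OF prod_integrable[OF D_continuous], of a \<tau>]
        has_integral_linear[OF z_integral[OF \<tau>_mem] prod_linear]
      by (intro has_integral_diff integrable_integral) (simp_all add: o_def)
    then show "\<phi> (z \<tau>) - integral {a..\<tau>} (\<lambda>\<sigma>. prod (D \<sigma>) (F \<sigma>))
        = (\<phi> (z \<tau>) - prod (D t) (z \<tau>)) - integral {a..\<tau>} (\<lambda>\<sigma>. prod (D \<sigma> - D t) (F \<sigma>)) + prod (D t) (z a)"
      by (simp add: integral_unique bilinear_rsub[OF prod_bilinear])
  qed simp
qed

lemma has_integral_chain_rule:
  fixes prod :: "'c::euclidean_space \<Rightarrow> 'a::euclidean_space \<Rightarrow> 'b::euclidean_space" and F z :: "real \<Rightarrow> 'a"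
  assumes prod_bilinear: "bilinear prod" and "a \<le> b"
    and z_integral: "\<And>t. t \<in> {a..b} \<Longrightarrow> (F has_integral (z t - z a)) {a..t}"
    and F_le: "\<And>t. t \<in> {a..b} \<Longrightarrow> norm (F t) \<le> M"
    and \<phi>_derivative: "\<And>t. t \<in> {a..b} \<Longrightarrow> (\<phi> has_derivative prod (D t)) (at (z t))"
    and D_continuous: "continuous_on {a..b} D"
  shows "((\<lambda>t. prod (D t) (F t)) has_integral (\<phi> (z b) - \<phi> (z a))) {a..b}"
proof -
  define defect where "defect t = \<phi> (z t) - integral {a..t} (\<lambda>\<sigma>. prod (D \<sigma>) (F \<sigma>))" for t
  have "(defect has_derivative (\<lambda>_. 0)) (at t within {a..b})" if "t \<in> {a..b}" for t
    unfolding defect_def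
    by (rule chain_rule_defect_has_derivative_zero[OF prod_bilinear z_integral F_le that
          \<phi>_derivative[OF that] D_continuous])
  then obtain q where "\<forall>t\<in>{a..b}. defect t = q"
    using has_derivative_zero_constant[OF convex_real_interval(5)] by blast
  then have "defect b = defect a" using \<open>a \<le> b\<close> by simp
  then have "integral {a..b} (\<lambda>t. prod (D t) (F t)) = \<phi> (z b) - \<phi> (z a)"
    by (simp add: defect_def diff_eq_eq)
  moreover have "F integrable_on {a..b}"
    using z_integral[of b] \<open>a \<le> b\<close> by auto
  then have "(\<lambda>t. prod (D t) (F t)) integrable_on {a..b}"
    by (rule bilinear_continuous_bounded_integrable[OF prod_bilinear D_continuous _ F_le])
  ultimately show ?thesis
    by (simp add: has_integral_iff)
qed

lemma has_integral_Pair: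
  assumes "(f has_integral I) S" "(g has_integral J) S"
  shows "((\<lambda>t. (f t, g t)) has_integral (I, J)) S"
proof -
  have "bounded_linear (\<lambda>u. (u, 0))" "bounded_linear (\<lambda>v. (0, v))"
    by (intro bounded_linear_Pair bounded_linear_ident bounded_linear_zero)+
  from has_integral_add[OF has_integral_linear[OF assms(1) this(1)] has_integral_linear[OF assms(2) this(2)]]
  show ?thesis by (simp add: o_def)
qed

lemma has_integral_by_parts_along_curve:
  fixes f :: "real^'n \<Rightarrow> real^'n" and F z :: "real \<Rightarrow> real^'n"
  assumes a_le_b: "a \<le> b"
    and z_integral: "\<And>t. t \<in> {a..b} \<Longrightarrow> (F has_integral (z t - z a)) {a..t}"
    and F_le: "\<And>t. t \<in> {a..b} \<Longrightarrow> norm (F t) \<le> M"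
    and f_differentiable: "\<And>t. t \<in> {a..b} \<Longrightarrow> f differentiable (at (z t))"
    and Jac_continuous: "continuous_on {a..b} (\<lambda>t. Jac f (z t))"
  shows "((\<lambda>t. f (z t) + (t - c) *\<^sub>R (Jac f (z t) *v F t))
    has_integral ((b - c) *\<^sub>R f (z b) - (a - c) *\<^sub>R f (z a))) {a..b}"
proof -
  define prod :: "(real^'n) \<times> (real^'n^'n) \<Rightarrow> real \<times> (real^'n) \<Rightarrow> real^'n"
    where "prod C h = fst h *\<^sub>R fst C + snd C *v snd h" for C h
  have "bilinear prod"
    unfolding bilinear_def prod_def
    by (auto intro!: linearI simp: matrix_vector_mult_add_rdistrib matrix_vector_right_distrib
        scaleR_matrix_vector_assoc matrix_vector_mult_scaleR algebra_simps)
  moreover have "((\<lambda>t. (1, F t)) has_integral ((t, z t) - (a, z a))) {a..t}" if "t \<in> {a..b}" for t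
    using has_integral_Pair[OF has_integral_const_real z_integral[OF that], of "1 :: real"] that by simp
  moreover have "norm (1 :: real, F t) \<le> 1 + M" if "t \<in> {a..b}" for t
    using norm_Pair_le[of "1 :: real" "F t"] F_le[OF that] by simp
  moreover have "((\<lambda>p. (fst p - c) *\<^sub>R f (snd p))
      has_derivative prod (f (z t), (t - c) *\<^sub>R Jac f (z t))) (at (t, z t))"
    if "t \<in> {a..b}" for t
  proof -
    have "((\<lambda>p. f (snd p)) has_derivative (\<lambda>h. Jac f (z t) *v snd h)) (at (t, z t))"
      using has_derivative_compose[OF has_derivative_snd[OF has_derivative_ident]]
          has_derivative_Jac[OF f_differentiable[OF that]]
      by fastforce
    then show ?thesis
      unfolding prod_def
      by (auto intro!: derivative_eq_intros simp: scaleR_matrix_vector_assoc)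
  qed
  moreover have "continuous_on {a..b} (\<lambda>t. (f (z t), (t - c) *\<^sub>R Jac f (z t)))"
  proof (intro continuous_intros Jac_continuous)
    have "continuous_on (z ` {a..b}) f"
      using f_differentiable by (auto intro!: continuous_at_imp_continuous_on differentiable_imp_continuous_within)
    then show "continuous_on {a..b} (\<lambda>t. f (z t))"
      using continuous_on_compose[OF lipschitz_on_continuous_on[OF
            indefinite_integral_lipschitz_on[OF a_le_b z_integral F_le]]]
      by (simp add: o_def)
  qed
  ultimately have "((\<lambda>t. prod (f (z t), (t - c) *\<^sub>R Jac f (z t)) (1, F t))
      has_integral (\<lambda>p. (fst p - c) *\<^sub>R f (snd p)) (b, z b) - (\<lambda>p. (fst p - c) *\<^sub>R f (snd p)) (a, z a)) {a..b}"
    by (rule has_integral_chain_rule[OF _ a_le_b])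
  then show ?thesis
    by (simp add: prod_def scaleR_matrix_vector_assoc)
qed

subsection \<open>Gronwall inequalities\<close>

lemma discrete_gronwall:
  fixes u :: "nat \<Rightarrow> real"
  assumes "\<Lambda> \<noteq> 0" "0 \<le> 1 + \<delta> * \<Lambda>" "u 0 \<le> 0"
    and "\<And>j. j < n \<Longrightarrow> u (Suc j) \<le> (1 + \<delta> * \<Lambda>) * u j + \<delta> * R"
  shows "u n \<le> R * (((1 + \<delta> * \<Lambda>) ^ n - 1) / \<Lambda>)"
  using assms(4)
proof (induction n)
  case 0
  then show ?case using assms(3) by simp
next
  case (Suc n)
  have "u (Suc n) \<le> (1 + \<delta> * \<Lambda>) * u n + \<delta> * R"
    by (rule Suc.prems) simp
  also have "\<dots> \<le> (1 + \<delta> * \<Lambda>) * (R * (((1 + \<delta> * \<Lambda>) ^ n - 1) / \<Lambda>)) + \<delta> * R"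
    using Suc assms(2) by (intro add_right_mono mult_left_mono) auto
  also have "\<dots> = R * (((1 + \<delta> * \<Lambda>) ^ Suc n - 1) / \<Lambda>)"
    using assms(1) by (simp add: field_simps)
  finally show ?case .
qed

text \<open>For \<open>\<Lambda> < 0\<close> the bound \<open>(1 + \<delta>\<Lambda>)\<^sup>n \<le> exp (n\<delta>\<Lambda>)\<close> points the wrong way after division by \<open>\<Lambda>\<close>,
  hence the limit over ever finer grids.\<close>

lemma gronwall_euler_steps:
  fixes u :: "real \<Rightarrow> real"
  assumes \<Lambda>_nonzero: "\<Lambda> \<noteq> 0" and init: "u a \<le> 0" and t_mem: "t \<in> {a..b}" and "0 < \<delta>\<^sub>0"
    and step: "\<And>s \<delta>. a \<le> s \<Longrightarrow> 0 \<le> \<delta> \<Longrightarrow> \<delta> \<le> \<delta>\<^sub>0 \<Longrightarrow> s + \<delta> \<le> b \<Longrightarrow>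
      u (s + \<delta>) \<le> (1 + \<delta> * \<Lambda>) * u s + \<delta> * (R + M * \<delta>)"
  shows "u t \<le> R * ((exp (\<Lambda> * (t - a)) - 1) / \<Lambda>)"
proof (rule tendsto_lowerbound)
  define \<delta> where "\<delta> n = (t - a) / real n" for n
  have \<delta>_lim: "\<delta> \<longlonglongrightarrow> 0"
    unfolding \<delta>_def by (rule lim_const_over_n)
  have "(\<lambda>n. (R + M * \<delta> n) * (((1 + \<Lambda> * (t - a) / real n) ^ n - 1) / \<Lambda>))
      \<longlonglongrightarrow> (R + M * 0) * ((exp (\<Lambda> * (t - a)) - 1) / \<Lambda>)"
    by (intro tendsto_intros \<delta>_lim tendsto_exp_limit_sequentially \<Lambda>_nonzero)
  then show "(\<lambda>n. (R + M * \<delta> n) * (((1 + \<delta> n * \<Lambda>) ^ n - 1) / \<Lambda>)) \<longlonglongrightarrow> R * ((exp (\<Lambda> * (t - a)) - 1) / \<Lambda>)"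
    by (simp add: \<delta>_def mult.commute)
  have "\<forall>\<^sub>F n in sequentially. \<delta> n < \<delta>\<^sub>0" "\<forall>\<^sub>F n in sequentially. \<delta> n < 1 / \<bar>\<Lambda>\<bar>"
    using \<delta>_lim \<open>0 < \<delta>\<^sub>0\<close> \<Lambda>_nonzero by (auto intro: order_tendstoD(2))
  then show "\<forall>\<^sub>F n in sequentially. u t \<le> (R + M * \<delta> n) * (((1 + \<delta> n * \<Lambda>) ^ n - 1) / \<Lambda>)"
    using eventually_gt_at_top[of 0]
  proof eventually_elim
    case (elim n)
    have \<delta>_grid: "0 \<le> \<delta> n" "n * \<delta> n = t - a"
      using elim(3) t_mem by (auto simp: \<delta>_def)
    have "\<delta> n * \<bar>\<Lambda>\<bar> < 1"
      using elim(2) \<Lambda>_nonzero by (simp add: field_simps)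
    then have "0 \<le> 1 + \<delta> n * \<Lambda>"
      using abs_ge_minus_self[of "\<delta> n * \<Lambda>"] \<delta>_grid(1) by (simp add: abs_mult)
    moreover have "u (a + Suc j * \<delta> n) \<le> (1 + \<delta> n * \<Lambda>) * u (a + j * \<delta> n) + \<delta> n * (R + M * \<delta> n)"
      if "j < n" for j
    proof -
      have "Suc j * \<delta> n \<le> n * \<delta> n"
        using that \<delta>_grid(1) by (intro mult_right_mono) auto
      then show ?thesis
        using step[of "a + j * \<delta> n" "\<delta> n"] \<delta>_grid elim(1) t_mem by (simp add: algebra_simps)
    qed
    ultimately have "u (a + n * \<delta> n) \<le> (R + M * \<delta> n) * (((1 + \<delta> n * \<Lambda>) ^ n - 1) / \<Lambda>)"
      using init by (intro discrete_gronwall[where u = "\<lambda>j. u (a + j * \<delta> n)"] \<Lambda>_nonzero) simp_all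
    then show ?case by (simp add: \<delta>_grid(2))
  qed
qed simp

lemma expm1_over_mono:
  fixes \<Lambda> :: real
  assumes "\<Lambda> \<noteq> 0" "s \<le> t"
  shows "(exp (\<Lambda> * s) - 1) / \<Lambda> \<le> (exp (\<Lambda> * t) - 1) / \<Lambda>"
proof (cases "\<Lambda> > 0")
  case True
  then show ?thesis using assms by (intro divide_right_mono) auto
next
  case False
  then have "\<Lambda> < 0" using assms by simp
  then show ?thesis using assms by (intro divide_right_mono_neg) (auto simp: mult_left_mono_neg)
qed

subsection \<open>Solutions of input-affine systems\<close>

locale bounded_system =
  fixes f :: "real^'n \<Rightarrow> real^'n" and g :: "nat \<Rightarrow> real^'n \<Rightarrow> real^'n" and m :: nat
    and B :: "(real^'n) set" and K L H \<Lambda> :: real and Ki Li :: "nat \<Rightarrow> real"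
  assumes B_convex: "convex B" and B_nonempty: "B \<noteq> {}"
    and f_differentiable: "\<And>z. z \<in> B \<Longrightarrow> f differentiable (at z)"
    and Jac_f_differentiable: "\<And>z. z \<in> B \<Longrightarrow> Jac f differentiable (at z)"
    and g_differentiable: "\<And>i z. i \<in> {1..m} \<Longrightarrow> z \<in> B \<Longrightarrow> g i differentiable (at z)"
    and f_le: "\<And>z. z \<in> B \<Longrightarrow> infnorm (f z) \<le> K"
    and g_le: "\<And>i z. i \<in> {1..m} \<Longrightarrow> z \<in> B \<Longrightarrow> infnorm (g i z) \<le> Ki i"
    and Jac_f_le: "\<And>z. z \<in> B \<Longrightarrow> mat_norm (Jac f z) \<le> L"
    and Jac_g_le: "\<And>i z. i \<in> {1..m} \<Longrightarrow> z \<in> B \<Longrightarrow> mat_norm (Jac (g i) z) \<le> Li i"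
    and d2_f_le: "\<And>z. z \<in> B \<Longrightarrow> d2_norm f z \<le> H"
    and log_norm_Jac_f_le: "\<And>z. z \<in> B \<Longrightarrow> log_norm (Jac f z) \<le> \<Lambda>"
begin

lemma bounds_nonneg:
  shows K_nonneg: "0 \<le> K" and L_nonneg: "0 \<le> L" and H_nonneg: "0 \<le> H"
    and Ki_nonneg: "i \<in> {1..m} \<Longrightarrow> 0 \<le> Ki i" and Li_nonneg: "i \<in> {1..m} \<Longrightarrow> 0 \<le> Li i"
proof -
  obtain z where z_mem: "z \<in> B" using B_nonempty by blast
  show "0 \<le> K" "0 \<le> L" "0 \<le> H"
    using order_trans[OF infnorm_pos_le f_le[OF z_mem]] order_trans[OF mat_norm_nonneg Jac_f_le[OF z_mem]]
      order_trans[OF d2_norm_nonneg[OF Jac_f_differentiable[OF z_mem]] d2_f_le[OF z_mem]] by simp_all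
  show "0 \<le> Ki i" "0 \<le> Li i" if "i \<in> {1..m}"
    using order_trans[OF infnorm_pos_le g_le[OF that z_mem]] order_trans[OF mat_norm_nonneg Jac_g_le[OF that z_mem]]
    by simp_all
qed

lemma f_lipschitz: "infnorm_lipschitz_on L B f"
  by (intro infnorm_lipschitz_on_mat_norm_Jac B_convex L_nonneg f_differentiable Jac_f_le)

lemma g_lipschitz: "i \<in> {1..m} \<Longrightarrow> infnorm_lipschitz_on (Li i) B (g i)"
  by (intro infnorm_lipschitz_on_mat_norm_Jac B_convex Li_nonneg g_differentiable Jac_g_le)

lemma lie_deriv_f_lipschitz: "infnorm_lipschitz_on (H * K + L\<^sup>2) B (lie_deriv f f)"
  unfolding power2_eq_square
  by (intro infnorm_lipschitz_on_lie_deriv B_convex bounds_nonneg Jac_f_differentiable d2_f_le Jac_f_le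
      f_lipschitz f_le)

lemma lie_deriv_g_lipschitz:
  "i \<in> {1..m} \<Longrightarrow> infnorm_lipschitz_on (H * Ki i + L * Li i) B (lie_deriv (g i) f)"
  by (intro infnorm_lipschitz_on_lie_deriv B_convex bounds_nonneg Jac_f_differentiable d2_f_le Jac_f_le
      g_lipschitz g_le)

definition input_bound :: "(nat \<Rightarrow> real) \<Rightarrow> real" where
  "input_bound U = (\<Sum>i\<in>{1..m}. U i * Ki i)"

definition speed :: "(nat \<Rightarrow> real) \<Rightarrow> real" where
  "speed U = K + input_bound U"

definition input_lipschitz :: "(nat \<Rightarrow> real) \<Rightarrow> real" where
  "input_lipschitz U = (\<Sum>i\<in>{1..m}. U i * Li i)"

definition input_error_const :: "(nat \<Rightarrow> real) \<Rightarrow> (nat \<Rightarrow> real) \<Rightarrow> real" where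
  "input_error_const V W = (\<Sum>i\<in>{1..m}. Li i * (speed V * (V i + W i) / 4 + (speed V + speed W) * W i / 2))"

definition local_error_const :: "(nat \<Rightarrow> real) \<Rightarrow> (nat \<Rightarrow> real) \<Rightarrow> real" where
  "local_error_const V W = L * (speed V + speed W) / 2 + input_error_const V W"

end

locale bounded_solution = bounded_system f g m B K L H \<Lambda> Ki Li
  for f :: "real^'n \<Rightarrow> real^'n" and g m B K L H \<Lambda> Ki Li +
  fixes a b :: real and u :: "nat \<Rightarrow> real \<Rightarrow> real" and U :: "nat \<Rightarrow> real" and z :: "real \<Rightarrow> real^'n"
  assumes a_less_b: "a < b"
    and input_measurable: "\<And>i. i \<in> {1..m} \<Longrightarrow> u i \<in> borel_measurable (lebesgue_on {a..b})"
    and input_le: "\<And>i t. i \<in> {1..m} \<Longrightarrow> t \<in> {a..b} \<Longrightarrow> \<bar>u i t\<bar> \<le> U i"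
    and z_sol: "is_sol f g m u a b z"
    and mem_B: "\<And>t. t \<in> {a..b} \<Longrightarrow> z t \<in> B"
begin

definition velocity :: "real \<Rightarrow> real^'n" where
  "velocity t = f (z t) + (\<Sum>i\<in>{1..m}. u i t *\<^sub>R g i (z t))"

lemma velocity_has_integral:
  "t \<in> {a..b} \<Longrightarrow> (velocity has_integral (z t - z a)) {a..t}"
  using z_sol unfolding is_sol_def velocity_def[abs_def] by blast

lemmas velocity_has_integral_subinterval = indefinite_integral_subinterval[OF velocity_has_integral]

lemma U_nonneg: "i \<in> {1..m} \<Longrightarrow> 0 \<le> U i"
  using input_le[of i a] a_less_b by force

lemma input_bound_nonneg: "0 \<le> input_bound U"
  unfolding input_bound_def using U_nonneg Ki_nonneg by (auto intro!: sum_nonneg)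

lemma input_lipschitz_nonneg: "0 \<le> input_lipschitz U"
  unfolding input_lipschitz_def using U_nonneg Li_nonneg by (auto intro!: sum_nonneg)

lemma speed_nonneg: "0 \<le> speed U"
  unfolding speed_def using K_nonneg input_bound_nonneg by simp

lemma infnorm_input_le:
  assumes "t \<in> {a..b}"
  shows "infnorm (\<Sum>i\<in>{1..m}. u i t *\<^sub>R g i (z t)) \<le> input_bound U"
  unfolding input_bound_def
proof (rule order_trans[OF infnorm_sum_le sum_mono])
  fix i assume "i \<in> {1..m}"
  then show "infnorm (u i t *\<^sub>R g i (z t)) \<le> U i * Ki i"
    unfolding infnorm_mul
    by (intro mult_mono input_le g_le mem_B assms U_nonneg infnorm_pos_le)
qed

lemma infnorm_velocity_le:
  assumes "t \<in> {a..b}"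
  shows "infnorm (velocity t) \<le> speed U"
  unfolding velocity_def speed_def
  by (intro order_trans[OF infnorm_triangle] add_mono f_le mem_B infnorm_input_le assms)

lemma solution_lipschitz: "infnorm_lipschitz_on (speed U) {a..b} z"
  unfolding infnorm_lipschitz_on_def
proof (intro conjI ballI speed_nonneg)
  have increment_le: "infnorm (z t - z s) \<le> speed U * (t - s)" if "s \<le> t" "s \<in> {a..b}" "t \<in> {a..b}" for s t
    using that by (intro infnorm_has_integral_const_le[OF velocity_has_integral_subinterval]
        infnorm_velocity_le) auto
  fix s t assume "s \<in> {a..b}" "t \<in> {a..b}"
  then show "infnorm (z s - z t) \<le> speed U * infnorm (s - t)"
    using increment_le[of s t] increment_le[of t s]
    by (cases "s \<le> t") (auto simp: infnorm_real infnorm_sub)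
qed

lemma lipschitz_along_solution:
  "infnorm_lipschitz_on l B A \<Longrightarrow> infnorm_lipschitz_on (l * speed U) {a..b} (\<lambda>t. A (z t))"
  by (rule infnorm_lipschitz_on_compose[OF _ solution_lipschitz]) (use mem_B in auto)

lemma continuous_along_solution:
  assumes "infnorm_lipschitz_on l B A"
  shows "continuous_on {a..b} (\<lambda>t. A (z t))"
  by (rule infnorm_lipschitz_on_imp_continuous_on[OF lipschitz_along_solution[OF assms]])

lemma input_scaleR_integrable:
  fixes \<phi> :: "real \<Rightarrow> 'b::euclidean_space"
  assumes "i \<in> {1..m}" "continuous_on {a..b} \<phi>"
  shows "(\<lambda>t. u i t *\<^sub>R \<phi> t) integrable_on {a..b}"
  by (rule bounded_measurable_scaleR_continuous_integrable[OF input_measurable[OF assms(1)]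
      input_le[OF assms(1)] assms(2)])

lemma euler_defect_le:
  assumes s_range: "a \<le> s" "s + \<delta> \<le> b" and \<delta>_nonneg: "0 \<le> \<delta>"
  shows "infnorm (z (s + \<delta>) - (z s + \<delta> *\<^sub>R f (z s))) \<le> \<delta> * (input_bound U + L * speed U * \<delta>)"
proof -
  have s_mem: "s \<in> {a..b}" using s_range \<delta>_nonneg by auto
  have "(velocity has_integral (z (s + \<delta>) - z s)) {s..s + \<delta>}"
    by (rule velocity_has_integral_subinterval) (use s_range \<delta>_nonneg in auto)
  from has_integral_diff[OF this has_integral_const_real[of "f (z s)"]]
  have "((\<lambda>\<tau>. velocity \<tau> - f (z s)) has_integral (z (s + \<delta>) - z s - \<delta> *\<^sub>R f (z s))) {s..s + \<delta>}"
    using \<delta>_nonneg by simp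
  then have "infnorm (z (s + \<delta>) - z s - \<delta> *\<^sub>R f (z s)) \<le> (input_bound U + L * speed U * \<delta>) * (s + \<delta> - s)"
  proof (rule infnorm_has_integral_const_le)
    fix \<tau> assume \<tau>_range: "\<tau> \<in> {s..s + \<delta>}"
    then have \<tau>_mem: "\<tau> \<in> {a..b}" using s_range by auto
    have "velocity \<tau> - f (z s) = (\<Sum>i\<in>{1..m}. u i \<tau> *\<^sub>R g i (z \<tau>)) + (f (z \<tau>) - f (z s))"
      by (simp add: velocity_def)
    then have "infnorm (velocity \<tau> - f (z s))
        \<le> infnorm (\<Sum>i\<in>{1..m}. u i \<tau> *\<^sub>R g i (z \<tau>)) + infnorm (f (z \<tau>) - f (z s))"
      by (simp only: infnorm_triangle)
    also have "\<dots> \<le> input_bound U + L * speed U * infnorm (\<tau> - s)"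
      by (intro add_mono infnorm_input_le infnorm_lipschitz_onD[OF lipschitz_along_solution[OF f_lipschitz]]
          s_mem \<tau>_mem)
    also have "\<dots> \<le> input_bound U + L * speed U * \<delta>"
      using \<tau>_range by (intro add_left_mono mult_left_mono mult_nonneg_nonneg L_nonneg speed_nonneg)
        (auto simp: infnorm_real)
    finally show "infnorm (velocity \<tau> - f (z s)) \<le> input_bound U + L * speed U * \<delta>" .
  qed (use \<delta>_nonneg in simp)
  then show ?thesis by (simp add: diff_diff_eq mult.commute)
qed

lemma drift_by_parts:
  "((\<lambda>t. f (z t) + (t - c) *\<^sub>R (Jac f (z t) *v velocity t))
    has_integral ((b - c) *\<^sub>R f (z b) - (a - c) *\<^sub>R f (z a))) {a..b}"
proof (rule has_integral_by_parts_along_curve)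
  show "a \<le> b" using a_less_b by simp
  show "norm (velocity t) \<le> sqrt DIM(real^'n) * speed U" if "t \<in> {a..b}" for t
    by (intro order_trans[OF norm_le_infnorm] mult_left_mono infnorm_velocity_le that) simp
  show "f differentiable (at (z t))" if "t \<in> {a..b}" for t
    by (rule f_differentiable[OF mem_B[OF that]])
  have "continuous_on (z ` {a..b}) (Jac f)"
    using Jac_f_differentiable mem_B
    by (auto intro!: continuous_at_imp_continuous_on differentiable_imp_continuous_within)
  then show "continuous_on {a..b} (\<lambda>t. Jac f (z t))"
    using continuous_on_compose[OF infnorm_lipschitz_on_imp_continuous_on[OF solution_lipschitz]]
    by (simp add: o_def)
qed (rule velocity_has_integral)

end

subsection \<open>Comparison of two solutions\<close>

locale solution_pair = bounded_system f g m B K L H \<Lambda> Ki Li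
    + x: bounded_solution f g m B K L H \<Lambda> Ki Li a b v V x
    + y: bounded_solution f g m B K L H \<Lambda> Ki Li a b w W y
  for f :: "real^'n \<Rightarrow> real^'n" and g m B K L H \<Lambda> Ki Li a b v V x w W y +
  assumes start: "y a = x a"
begin

lemma error_le_linear:
  assumes t_mem: "t \<in> {a..b}"
  shows "infnorm (x t - y t) \<le> (speed V + speed W) * (t - a)"
proof -
  have a_mem: "a \<in> {a..b}" using x.a_less_b by simp
  have "x t - y t = (x t - x a) + (y a - y t)" by (simp add: start)
  then have "infnorm (x t - y t) \<le> infnorm (x t - x a) + infnorm (y a - y t)"
    by (simp only: infnorm_triangle)
  also have "\<dots> \<le> speed V * infnorm (t - a) + speed W * infnorm (a - t)"
    by (intro add_mono infnorm_lipschitz_onD[OF x.solution_lipschitz]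
        infnorm_lipschitz_onD[OF y.solution_lipschitz] a_mem t_mem)
  also have "\<dots> = (speed V + speed W) * (t - a)"
    using t_mem by (simp add: infnorm_real distrib_right)
  finally show ?thesis .
qed

lemma error_euler_step_le:
  assumes s_range: "a \<le> s" "s + \<delta> \<le> b" and \<delta>_bounds: "0 \<le> \<delta>" "\<delta> * L \<le> 1"
  shows "infnorm (x (s + \<delta>) - y (s + \<delta>)) \<le> (1 + \<delta> * \<Lambda>) * infnorm (x s - y s)
    + \<delta> * (input_bound V + input_bound W + L * (speed V + speed W) * \<delta>)"
proof -
  have s_mem: "s \<in> {a..b}" using s_range \<delta>_bounds by auto
  let ?step_x = "x s + \<delta> *\<^sub>R f (x s)" and ?step_y = "y s + \<delta> *\<^sub>R f (y s)"
  have "x (s + \<delta>) - y (s + \<delta>) = (?step_x - ?step_y) + ((x (s + \<delta>) - ?step_x) + (?step_y - y (s + \<delta>)))"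
    by simp
  then have "infnorm (x (s + \<delta>) - y (s + \<delta>))
      \<le> infnorm (?step_x - ?step_y) + infnorm ((x (s + \<delta>) - ?step_x) + (?step_y - y (s + \<delta>)))"
    by (simp only: infnorm_triangle)
  also have "\<dots> \<le> infnorm (?step_x - ?step_y)
      + (infnorm (x (s + \<delta>) - ?step_x) + infnorm (y (s + \<delta>) - ?step_y))"
    unfolding infnorm_sub[of "y (s + \<delta>)"] by (intro add_left_mono infnorm_triangle)
  also have "\<dots> \<le> (1 + \<delta> * \<Lambda>) * infnorm (x s - y s)
      + (\<delta> * (input_bound V + L * speed V * \<delta>) + \<delta> * (input_bound W + L * speed W * \<delta>))"
    by (intro add_mono infnorm_euler_step_diff_le[where L = L, OF B_convex] x.euler_defect_le
        y.euler_defect_le s_range \<delta>_bounds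
        x.mem_B y.mem_B s_mem f_differentiable Jac_f_le log_norm_Jac_f_le)
  finally show ?thesis by (simp add: algebra_simps)
qed

lemma error_le_exponential:
  assumes "\<Lambda> \<noteq> 0" "t \<in> {a..b}"
  shows "infnorm (x t - y t) \<le> (input_bound V + input_bound W) * ((exp (\<Lambda> * (t - a)) - 1) / \<Lambda>)"
proof (rule gronwall_euler_steps[OF assms(1) _ assms(2)])
  show "infnorm (x a - y a) \<le> 0" by (simp add: start infnorm_0)
  show "0 < 1 / (L + 1)" using L_nonneg by simp
  fix s \<delta> assume s_range: "a \<le> s" "s + \<delta> \<le> b" and \<delta>_bounds: "0 \<le> \<delta>" "\<delta> \<le> 1 / (L + 1)"
  have "\<delta> * L \<le> 1"
    using \<delta>_bounds L_nonneg by (simp add: field_simps)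
  with s_range \<delta>_bounds(1) show "infnorm (x (s + \<delta>) - y (s + \<delta>)) \<le> (1 + \<delta> * \<Lambda>) * infnorm (x s - y s)
      + \<delta> * (input_bound V + input_bound W + L * (speed V + speed W) * \<delta>)"
    by (rule error_euler_step_le)
qed

lemma drift_difference_integrable:
  assumes "infnorm_lipschitz_on l B A" "continuous_on {a..b} \<rho>"
  shows "(\<lambda>t. \<rho> t *\<^sub>R (A (x t) - A (y t))) integrable_on {a..b}"
  by (intro integrable_continuous_real continuous_on_scaleR continuous_on_diff assms(2)
      x.continuous_along_solution[OF assms(1)] y.continuous_along_solution[OF assms(1)])

lemma drift_difference_le:
  assumes A_lipschitz: "infnorm_lipschitz_on l B A"
    and \<rho>_continuous: "continuous_on {a..b} \<rho>" and \<eta>_continuous: "continuous_on {a..b} \<eta>"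
    and error_le: "\<And>t. t \<in> {a..b} \<Longrightarrow> infnorm (x t - y t) \<le> \<eta> t"
  shows "infnorm (integral {a..b} (\<lambda>t. \<rho> t *\<^sub>R (A (x t) - A (y t))))
    \<le> l * integral {a..b} (\<lambda>t. \<bar>\<rho> t\<bar> * \<eta> t)"
proof (rule infnorm_has_integral_le)
  show "((\<lambda>t. \<rho> t *\<^sub>R (A (x t) - A (y t))) has_integral
      integral {a..b} (\<lambda>t. \<rho> t *\<^sub>R (A (x t) - A (y t)))) {a..b}"
    by (intro integrable_integral drift_difference_integrable[OF A_lipschitz] \<rho>_continuous)
  show "((\<lambda>t. l * (\<bar>\<rho> t\<bar> * \<eta> t)) has_integral l * integral {a..b} (\<lambda>t. \<bar>\<rho> t\<bar> * \<eta> t)) {a..b}"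
    by (intro has_integral_mult_right integrable_integral integrable_continuous_real continuous_intros
        \<rho>_continuous \<eta>_continuous)
  fix t assume t_mem: "t \<in> {a..b}"
  have "infnorm (A (x t) - A (y t)) \<le> l * \<eta> t"
    by (intro order_trans[OF infnorm_lipschitz_onD[OF A_lipschitz]] mult_left_mono error_le x.mem_B y.mem_B t_mem
        infnorm_lipschitz_on_nonneg[OF A_lipschitz])
  then have "\<bar>\<rho> t\<bar> * infnorm (A (x t) - A (y t)) \<le> \<bar>\<rho> t\<bar> * (l * \<eta> t)"
    by (intro mult_left_mono) auto
  then show "infnorm (\<rho> t *\<^sub>R (A (x t) - A (y t))) \<le> l * (\<bar>\<rho> t\<bar> * \<eta> t)"
    by (simp add: infnorm_mul mult.left_commute)
qed

lemma mismatch_measurable: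
  "i \<in> {1..m} \<Longrightarrow> (\<lambda>t. v i t - w i t) \<in> borel_measurable (lebesgue_on {a..b})"
  by (intro borel_measurable_diff x.input_measurable y.input_measurable)

lemma mismatch_le: "i \<in> {1..m} \<Longrightarrow> t \<in> {a..b} \<Longrightarrow> \<bar>v i t - w i t\<bar> \<le> V i + W i"
  using x.input_le[of i t] y.input_le[of i t] by linarith

lemma abs_mismatch_mult_integrable:
  assumes "i \<in> {1..m}" "continuous_on {a..b} \<rho>"
  shows "(\<lambda>t. \<bar>v i t - w i t\<bar> * \<rho> t) integrable_on {a..b}"
  using bounded_measurable_scaleR_continuous_integrable[of "\<lambda>t. \<bar>v i t - w i t\<bar>" a b "V i + W i" \<rho>] assms
  by (simp add: borel_measurable_abs mismatch_measurable mismatch_le)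

lemma input_difference_integrable:
  assumes "i \<in> {1..m}" "infnorm_lipschitz_on l B A" "continuous_on {a..b} \<rho>"
  shows "(\<lambda>t. \<rho> t *\<^sub>R (v i t *\<^sub>R A (x t) - w i t *\<^sub>R A (y t))) integrable_on {a..b}"
proof -
  have "(\<lambda>t. v i t *\<^sub>R (\<rho> t *\<^sub>R A (x t)) - w i t *\<^sub>R (\<rho> t *\<^sub>R A (y t))) integrable_on {a..b}"
    by (intro integrable_diff x.input_scaleR_integrable y.input_scaleR_integrable continuous_on_scaleR assms
        x.continuous_along_solution[OF assms(2)] y.continuous_along_solution[OF assms(2)])
  then show ?thesis by (simp add: scaleR_diff_right mult.commute)
qed

abbreviation mid :: real where
  "mid \<equiv> (a + b) / 2"

lemma centered_input_difference_le:
  assumes i_mem: "i \<in> {1..m}" and A_lipschitz: "infnorm_lipschitz_on l B A" and t_mem: "t \<in> {a..b}"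
  shows "infnorm (v i t *\<^sub>R A (x t) - w i t *\<^sub>R A (y t) - (v i t - w i t) *\<^sub>R A (x mid))
    \<le> l * (speed V * (\<bar>v i t - w i t\<bar> * \<bar>t - mid\<bar>) + W i * infnorm (x t - y t))"
proof -
  let ?d = "v i t - w i t"
  have mid_mem: "mid \<in> {a..b}" using x.a_less_b by auto
  have "v i t *\<^sub>R A (x t) - w i t *\<^sub>R A (y t) - ?d *\<^sub>R A (x mid)
      = ?d *\<^sub>R (A (x t) - A (x mid)) + w i t *\<^sub>R (A (x t) - A (y t))"
    by (simp add: algebra_simps)
  then have "infnorm (v i t *\<^sub>R A (x t) - w i t *\<^sub>R A (y t) - ?d *\<^sub>R A (x mid))
      \<le> \<bar>?d\<bar> * infnorm (A (x t) - A (x mid)) + \<bar>w i t\<bar> * infnorm (A (x t) - A (y t))"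
    unfolding infnorm_mul[symmetric] by (simp only: infnorm_triangle)
  also have "\<dots> \<le> \<bar>?d\<bar> * (l * speed V * infnorm (t - mid)) + W i * (l * infnorm (x t - y t))"
    by (intro add_mono mult_mono mult_left_mono y.input_le i_mem t_mem y.U_nonneg infnorm_pos_le abs_ge_zero
        x.mem_B y.mem_B
        infnorm_lipschitz_onD[OF A_lipschitz] mid_mem
        infnorm_lipschitz_onD[OF x.lipschitz_along_solution[OF A_lipschitz]])
  also have "\<dots> = l * (speed V * (\<bar>?d\<bar> * \<bar>t - mid\<bar>) + W i * infnorm (x t - y t))"
    by (simp add: infnorm_real algebra_simps)
  finally show ?thesis .
qed

text \<open>Since \<open>\<rho> (v\<^sub>i - w\<^sub>i)\<close> has mean zero, \<open>A (x mid)\<close> may be subtracted from \<open>A (x t)\<close>, which gains a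
  factor \<open>\<bar>t - mid\<bar>\<close>.\<close>

lemma input_difference_le:
  assumes i_mem: "i \<in> {1..m}" and A_lipschitz: "infnorm_lipschitz_on l B A"
    and \<rho>_continuous: "continuous_on {a..b} \<rho>" and \<eta>_continuous: "continuous_on {a..b} \<eta>"
    and weighted_mean_zero: "integral {a..b} (\<lambda>t. \<rho> t * (v i t - w i t)) = 0"
    and error_le: "\<And>t. t \<in> {a..b} \<Longrightarrow> infnorm (x t - y t) \<le> \<eta> t"
  shows "infnorm (integral {a..b} (\<lambda>t. \<rho> t *\<^sub>R (v i t *\<^sub>R A (x t) - w i t *\<^sub>R A (y t))))
    \<le> l * (speed V * integral {a..b} (\<lambda>t. \<bar>v i t - w i t\<bar> * (\<bar>\<rho> t\<bar> * \<bar>t - mid\<bar>))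
        + W i * integral {a..b} (\<lambda>t. \<bar>\<rho> t\<bar> * \<eta> t))"
proof (rule infnorm_has_integral_le)
  let ?d = "\<lambda>t. v i t - w i t" and ?D = "\<lambda>t. v i t *\<^sub>R A (x t) - w i t *\<^sub>R A (y t)"
  have "(\<lambda>t. \<rho> t * ?d t) integrable_on {a..b}"
    using integrable_diff[OF x.input_scaleR_integrable[OF i_mem \<rho>_continuous]
        y.input_scaleR_integrable[OF i_mem \<rho>_continuous]]
    by (simp add: algebra_simps)
  then have "((\<lambda>t. \<rho> t * ?d t) has_integral 0) {a..b}"
    using weighted_mean_zero by (simp add: has_integral_iff)
  from has_integral_diff[OF integrable_integral[OF input_difference_integrable[OF i_mem A_lipschitz \<rho>_continuous]]
      has_integral_scaleR_left[OF this, of "A (x mid)"]]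
  show "((\<lambda>t. \<rho> t *\<^sub>R (?D t - ?d t *\<^sub>R A (x mid))) has_integral integral {a..b} (\<lambda>t. \<rho> t *\<^sub>R ?D t)) {a..b}"
    by (simp add: scaleR_diff_right[of "\<rho> _" "?D _"])
  show "((\<lambda>t. l * (speed V * (\<bar>?d t\<bar> * (\<bar>\<rho> t\<bar> * \<bar>t - mid\<bar>)) + W i * (\<bar>\<rho> t\<bar> * \<eta> t))) has_integral
      l * (speed V * integral {a..b} (\<lambda>t. \<bar>?d t\<bar> * (\<bar>\<rho> t\<bar> * \<bar>t - mid\<bar>))
        + W i * integral {a..b} (\<lambda>t. \<bar>\<rho> t\<bar> * \<eta> t))) {a..b}"
    by (intro has_integral_mult_right has_integral_add integrable_integral abs_mismatch_mult_integrable i_mem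
        integrable_continuous_real continuous_intros \<rho>_continuous \<eta>_continuous)
  fix t assume t_mem: "t \<in> {a..b}"
  have "infnorm (?D t - ?d t *\<^sub>R A (x mid)) \<le> l * (speed V * (\<bar>?d t\<bar> * \<bar>t - mid\<bar>) + W i * \<eta> t)"
    by (intro order_trans[OF centered_input_difference_le[OF i_mem A_lipschitz t_mem]] mult_left_mono
        add_left_mono error_le t_mem
        y.U_nonneg i_mem infnorm_lipschitz_on_nonneg[OF A_lipschitz])
  then have "\<bar>\<rho> t\<bar> * infnorm (?D t - ?d t *\<^sub>R A (x mid))
      \<le> \<bar>\<rho> t\<bar> * (l * (speed V * (\<bar>?d t\<bar> * \<bar>t - mid\<bar>) + W i * \<eta> t))"
    by (rule mult_left_mono) simp
  then show "infnorm (\<rho> t *\<^sub>R (?D t - ?d t *\<^sub>R A (x mid)))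
      \<le> l * (speed V * (\<bar>?d t\<bar> * (\<bar>\<rho> t\<bar> * \<bar>t - mid\<bar>)) + W i * (\<bar>\<rho> t\<bar> * \<eta> t))"
    by (simp only: infnorm_mul distrib_left mult_ac)
qed

lemma error_eq_integrals:
  "x b - y b = integral {a..b} (\<lambda>t. f (x t) - f (y t))
    + (\<Sum>i\<in>{1..m}. integral {a..b} (\<lambda>t. v i t *\<^sub>R g i (x t) - w i t *\<^sub>R g i (y t)))"
proof (rule has_integral_unique)
  have "(x.velocity has_integral (x b - x a)) {a..b}" "(y.velocity has_integral (y b - y a)) {a..b}"
    using x.velocity_has_integral[of b] y.velocity_has_integral[of b] x.a_less_b by simp_all
  from has_integral_diff[OF this]
  show "((\<lambda>t. x.velocity t - y.velocity t) has_integral x b - y b) {a..b}"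
    by (simp add: start)
  have "((\<lambda>t. (f (x t) - f (y t)) + (\<Sum>i\<in>{1..m}. v i t *\<^sub>R g i (x t) - w i t *\<^sub>R g i (y t))) has_integral
      integral {a..b} (\<lambda>t. f (x t) - f (y t))
        + (\<Sum>i\<in>{1..m}. integral {a..b} (\<lambda>t. v i t *\<^sub>R g i (x t) - w i t *\<^sub>R g i (y t)))) {a..b}"
    using drift_difference_integrable[OF f_lipschitz continuous_on_const[of "{a..b}" 1]]
      input_difference_integrable[OF _ g_lipschitz continuous_on_const[of "{a..b}" 1]]
    by (intro has_integral_add has_integral_sum integrable_integral) auto
  then show "((\<lambda>t. x.velocity t - y.velocity t) has_integral
      integral {a..b} (\<lambda>t. f (x t) - f (y t))
        + (\<Sum>i\<in>{1..m}. integral {a..b} (\<lambda>t. v i t *\<^sub>R g i (x t) - w i t *\<^sub>R g i (y t)))) {a..b}"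
    by (simp add: x.velocity_def y.velocity_def sum_subtractf algebra_simps)
qed

lemma Jac_velocity_diff:
  "Jac f (x t) *v x.velocity t - Jac f (y t) *v y.velocity t
    = (lie_deriv f f (x t) - lie_deriv f f (y t))
      + (\<Sum>i\<in>{1..m}. v i t *\<^sub>R lie_deriv (g i) f (x t) - w i t *\<^sub>R lie_deriv (g i) f (y t))"
  unfolding x.velocity_def y.velocity_def lie_deriv_def matrix_vector_right_distrib
    linear_sum[OF matrix_vector_mul_linear] matrix_vector_mult_scaleR sum_subtractf
  by simp

lemma drift_error_eq_integrals:
  "integral {a..b} (\<lambda>t. f (x t) - f (y t)) = ((b - a) / 2) *\<^sub>R (f (x b) - f (y b))
    - (integral {a..b} (\<lambda>t. (t - mid) *\<^sub>R (lie_deriv f f (x t) - lie_deriv f f (y t)))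
      + (\<Sum>i\<in>{1..m}. integral {a..b} (\<lambda>t. (t - mid) *\<^sub>R
          (v i t *\<^sub>R lie_deriv (g i) f (x t) - w i t *\<^sub>R lie_deriv (g i) f (y t)))))"
    (is "?drift = _ - ?weighted")
proof -
  have half: "b - mid = (b - a) / 2" by (simp add: field_simps)
  have "((\<lambda>t. (t - mid) *\<^sub>R (lie_deriv f f (x t) - lie_deriv f f (y t))
      + (\<Sum>i\<in>{1..m}. (t - mid) *\<^sub>R (v i t *\<^sub>R lie_deriv (g i) f (x t) - w i t *\<^sub>R lie_deriv (g i) f (y t))))
      has_integral ?weighted) {a..b}"
    by (intro has_integral_add has_integral_sum integrable_integral continuous_intros finite_atLeastAtMost
        drift_difference_integrable[OF lie_deriv_f_lipschitz]
        input_difference_integrable[OF _ lie_deriv_g_lipschitz])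
  then have weighted: "((\<lambda>t. (t - mid) *\<^sub>R (Jac f (x t) *v x.velocity t - Jac f (y t) *v y.velocity t))
      has_integral ?weighted) {a..b}"
    by (simp add: Jac_velocity_diff scaleR_right_distrib scaleR_sum_right)
  have "((\<lambda>t. (f (x t) + (t - mid) *\<^sub>R (Jac f (x t) *v x.velocity t))
        - (f (y t) + (t - mid) *\<^sub>R (Jac f (y t) *v y.velocity t)))
      has_integral ((b - a) / 2) *\<^sub>R (f (x b) - f (y b))) {a..b}"
    using has_integral_diff[OF x.drift_by_parts[of mid] y.drift_by_parts[of mid]]
    by (simp add: start half scaleR_diff_right)
  from has_integral_diff[OF this weighted]
  have "((\<lambda>t. f (x t) - f (y t)) has_integral ((b - a) / 2) *\<^sub>R (f (x b) - f (y b)) - ?weighted) {a..b}"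
    by (simp add: algebra_simps)
  then show ?thesis by (rule integral_unique)
qed

end

locale matched_pair = solution_pair f g m B K L H \<Lambda> Ki Li a b v V x w W y
  for f :: "real^'n \<Rightarrow> real^'n" and g m B K L H \<Lambda> Ki Li a b v V x w W y +
  assumes mean_eq: "\<And>i. i \<in> {1..m} \<Longrightarrow> integral {a..b} (\<lambda>t. v i t - w i t) = 0"
begin

lemma input_error_le:
  "infnorm (\<Sum>i\<in>{1..m}. integral {a..b} (\<lambda>t. v i t *\<^sub>R g i (x t) - w i t *\<^sub>R g i (y t)))
    \<le> input_error_const V W * (b - a)\<^sup>2"
  unfolding input_error_const_def sum_distrib_right
proof (rule order_trans[OF infnorm_sum_le sum_mono])
  fix i assume i_mem: "i \<in> {1..m}"
  have "infnorm (integral {a..b} (\<lambda>t. v i t *\<^sub>R g i (x t) - w i t *\<^sub>R g i (y t)))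
      \<le> Li i * (speed V * integral {a..b} (\<lambda>t. \<bar>v i t - w i t\<bar> * \<bar>t - mid\<bar>)
          + W i * integral {a..b} (\<lambda>t. (speed V + speed W) * (t - a)))"
    using input_difference_le[OF i_mem g_lipschitz[OF i_mem] continuous_on_const[of _ 1] _ _ error_le_linear]
      mean_eq[OF i_mem]
    by (simp add: continuous_intros)
  also have "\<dots> \<le> Li i * (speed V * integral {a..b} (\<lambda>t. (V i + W i) * \<bar>t - mid\<bar>)
        + W i * integral {a..b} (\<lambda>t. (speed V + speed W) * (t - a)))"
    by (intro mult_left_mono add_right_mono integral_le abs_mismatch_mult_integrable i_mem
        integrable_continuous_real
        continuous_intros mult_right_mono mismatch_le Li_nonneg x.speed_nonneg) auto
  also have "\<dots> = Li i * (speed V * (V i + W i) / 4 + (speed V + speed W) * W i / 2) * (b - a)\<^sup>2"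
    unfolding integral_mult_right integral_abs_midpoint[OF less_imp_le[OF x.a_less_b]]
      integral_linear[OF less_imp_le[OF x.a_less_b]]
    by (simp add: algebra_simps)
  finally show "infnorm (integral {a..b} (\<lambda>t. v i t *\<^sub>R g i (x t) - w i t *\<^sub>R g i (y t)))
      \<le> Li i * (speed V * (V i + W i) / 4 + (speed V + speed W) * W i / 2) * (b - a)\<^sup>2" .
qed

lemma local_error_quadratic: "infnorm (x b - y b) \<le> local_error_const V W * (b - a)\<^sup>2"
proof -
  have "infnorm (integral {a..b} (\<lambda>t. f (x t) - f (y t)))
      \<le> L * integral {a..b} (\<lambda>t. (speed V + speed W) * (t - a))"
    using drift_difference_le[OF f_lipschitz continuous_on_const[of _ 1] _ error_le_linear]
    by (simp add: continuous_intros)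
  also have "\<dots> = L * (speed V + speed W) / 2 * (b - a)\<^sup>2"
    using x.a_less_b by (simp add: integral_linear)
  finally have "infnorm (x b - y b) \<le> L * (speed V + speed W) / 2 * (b - a)\<^sup>2 + input_error_const V W * (b - a)\<^sup>2"
    unfolding error_eq_integrals
    by (intro order_trans[OF infnorm_triangle] add_mono input_error_le)
  then show ?thesis
    by (simp add: local_error_const_def distrib_right)
qed

lemma drift_error_le:
  assumes moment_eq: "\<And>i. i \<in> {1..m} \<Longrightarrow> integral {a..b} (\<lambda>t. (t - mid) * (v i t - w i t)) = 0"
    and error_le: "\<And>t. t \<in> {a..b} \<Longrightarrow> infnorm (x t - y t) \<le> M"
  shows "infnorm (integral {a..b} (\<lambda>t. f (x t) - f (y t)))
    \<le> (b - a) / 2 * (L * infnorm (x b - y b)) + (H * K + L\<^sup>2) * (M * (b - a)\<^sup>2 / 4)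
      + (\<Sum>i\<in>{1..m}. (H * Ki i + L * Li i)
          * (speed V * integral {a..b} (\<lambda>t. \<bar>v i t - w i t\<bar> * (t - mid)\<^sup>2) + W i * (M * (b - a)\<^sup>2 / 4)))"
proof -
  let ?boundary = "((b - a) / 2) *\<^sub>R (f (x b) - f (y b))"
    and ?A = "integral {a..b} (\<lambda>t. (t - mid) *\<^sub>R (lie_deriv f f (x t) - lie_deriv f f (y t)))"
    and ?C = "\<lambda>i. integral {a..b} (\<lambda>t. (t - mid) *\<^sub>R
      (v i t *\<^sub>R lie_deriv (g i) f (x t) - w i t *\<^sub>R lie_deriv (g i) f (y t)))"
  have weight: "continuous_on {a..b} (\<lambda>t. t - mid)" "integral {a..b} (\<lambda>t. \<bar>t - mid\<bar> * M) = M * (b - a)\<^sup>2 / 4"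
    using x.a_less_b by (simp_all add: continuous_intros integral_abs_midpoint)
  have b_mem: "b \<in> {a..b}" using x.a_less_b by simp
  have boundary_le: "infnorm ?boundary \<le> (b - a) / 2 * (L * infnorm (x b - y b))"
    unfolding infnorm_mul using x.a_less_b
    by (simp add: mult_left_mono infnorm_lipschitz_onD[OF f_lipschitz x.mem_B[OF b_mem] y.mem_B[OF b_mem]])
  have autonomous_le: "infnorm ?A \<le> (H * K + L\<^sup>2) * (M * (b - a)\<^sup>2 / 4)"
    using drift_difference_le[OF lie_deriv_f_lipschitz weight(1) continuous_on_const error_le] unfolding weight(2) .
  have input_le: "infnorm (?C i) \<le> (H * Ki i + L * Li i)
      * (speed V * integral {a..b} (\<lambda>t. \<bar>v i t - w i t\<bar> * (t - mid)\<^sup>2) + W i * (M * (b - a)\<^sup>2 / 4))"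
    if i_mem: "i \<in> {1..m}" for i
    using input_difference_le[OF i_mem lie_deriv_g_lipschitz[OF i_mem] weight(1) continuous_on_const
        moment_eq[OF i_mem] error_le]
    unfolding weight(2) abs_mult_self_eq power2_eq_square .
  have "infnorm (integral {a..b} (\<lambda>t. f (x t) - f (y t))) \<le> infnorm ?boundary + infnorm (?A + (\<Sum>i\<in>{1..m}. ?C i))"
    unfolding drift_error_eq_integrals by (rule infnorm_triangle_diff)
  also have "\<dots> \<le> infnorm ?boundary + (infnorm ?A + (\<Sum>i\<in>{1..m}. infnorm (?C i)))"
    by (intro add_left_mono order_trans[OF infnorm_triangle] infnorm_sum_le)
  also have "\<dots> = infnorm ?boundary + infnorm ?A + (\<Sum>i\<in>{1..m}. infnorm (?C i))"
    by simp
  also have "\<dots> \<le> (b - a) / 2 * (L * infnorm (x b - y b)) + (H * K + L\<^sup>2) * (M * (b - a)\<^sup>2 / 4)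
      + (\<Sum>i\<in>{1..m}. (H * Ki i + L * Li i)
          * (speed V * integral {a..b} (\<lambda>t. \<bar>v i t - w i t\<bar> * (t - mid)\<^sup>2) + W i * (M * (b - a)\<^sup>2 / 4)))"
    by (intro add_mono sum_mono boundary_le autonomous_le input_le)
  finally show ?thesis .
qed

end

subsection \<open>Affine controls\<close>

locale affine_matched_pair = bounded_system f g m B K L H \<Lambda> Ki Li
    + x: bounded_solution f g m B K L H \<Lambda> Ki Li a b v V x
  for f :: "real^'n \<Rightarrow> real^'n" and g m B K L H \<Lambda> Ki Li a b v V x +
  fixes w :: "nat \<Rightarrow> real \<Rightarrow> real" and y :: "real \<Rightarrow> real^'n"
  assumes affine: "\<And>i. i \<in> {1..m} \<Longrightarrow> \<exists>p q. \<forall>t\<in>{a..b}. w i t = p + q * t"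
    and y_sol: "is_sol f g m w a b y" and y_mem_B: "\<And>t. t \<in> {a..b} \<Longrightarrow> y t \<in> B"
    and y_start: "y a = x a"
    and mean_zero: "\<And>i. i \<in> {1..m} \<Longrightarrow> integral {a..b} (\<lambda>t. v i t - w i t) = 0"
    and moment_zero: "\<And>i. i \<in> {1..m} \<Longrightarrow> integral {a..b} (\<lambda>t. (t - (a + b) / 2) * (v i t - w i t)) = 0"
    and \<Lambda>_nonzero: "\<Lambda> \<noteq> 0"
begin

lemma w_measurable: "i \<in> {1..m} \<Longrightarrow> w i \<in> borel_measurable (lebesgue_on {a..b})"
  by (rule continuous_imp_measurable_on_sets_lebesgue[OF affine_imp_continuous_on[OF affine]]) auto

lemma abs_w_le: "i \<in> {1..m} \<Longrightarrow> t \<in> {a..b} \<Longrightarrow> \<bar>w i t\<bar> \<le> 2 * V i"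
  by (rule affine_projection_abs_le[OF x.input_measurable x.input_le x.a_less_b affine mean_zero moment_zero])

lemma mismatch_integral_square_le:
  "i \<in> {1..m} \<Longrightarrow> integral {a..b} (\<lambda>t. (v i t - w i t)\<^sup>2) \<le> (V i)\<^sup>2 * (b - a)"
  by (rule affine_projection_integral_square_le(2)[OF x.input_measurable x.input_le less_imp_le[OF x.a_less_b]
        affine mean_zero moment_zero])

end

sublocale affine_matched_pair \<subseteq> matched_pair f g m B K L H \<Lambda> Ki Li a b v V x w "\<lambda>i. 2 * V i" y
  by unfold_locales (fact x.a_less_b w_measurable abs_w_le y_sol y_mem_B y_start mean_zero)+

context affine_matched_pair
begin

lemma input_bound_double: "input_bound (\<lambda>i. 2 * V i) = 2 * input_bound V"
  by (simp add: input_bound_def sum_distrib_left mult.assoc)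

lemma input_error_const_double:
  "input_error_const V (\<lambda>i. 2 * V i) = input_lipschitz V * (11 * K + 15 * input_bound V) / 4"
proof -
  have "input_error_const V (\<lambda>i. 2 * V i) = (\<Sum>i\<in>{1..m}. V i * Li i * ((11 * K + 15 * input_bound V) / 4))"
    unfolding input_error_const_def speed_def input_bound_double
    by (intro sum.cong) (simp_all add: field_simps)
  then show ?thesis
    by (simp add: input_lipschitz_def sum_distrib_right)
qed

lemma mismatch_second_moment_le:
  assumes i_mem: "i \<in> {1..m}"
  shows "integral {a..b} (\<lambda>t. \<bar>v i t - w i t\<bar> * (t - mid)\<^sup>2) \<le> V i * (b - a) ^ 3 / 8"
proof (rule power2_le_imp_le)
  let ?h = "b - a"
  have h_pos: "0 < ?h" using x.a_less_b by simp
  show "0 \<le> V i * ?h ^ 3 / 8" using h_pos x.U_nonneg[OF i_mem] by simp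
  have "(integral {a..b} (\<lambda>t. \<bar>v i t - w i t\<bar> * (t - mid)\<^sup>2))\<^sup>2
      \<le> integral {a..b} (\<lambda>t. \<bar>v i t - w i t\<bar>\<^sup>2) * integral {a..b} (\<lambda>t. ((t - mid)\<^sup>2)\<^sup>2)"
    using bounded_measurable_square_integrable[OF mismatch_measurable[OF i_mem] mismatch_le[OF i_mem]]
    by (intro integral_Cauchy_Schwarz abs_mismatch_mult_integrable i_mem)
      (simp_all add: integrable_continuous_real continuous_intros)
  also have "\<dots> \<le> (V i)\<^sup>2 * ?h * (?h ^ 5 / 80)"
    using mismatch_integral_square_le[OF i_mem] h_pos
    by (simp add: power_mult[symmetric] integral_midpoint_power4 divide_right_mono mult_right_mono)
  also have "\<dots> = (V i * ?h ^ 3)\<^sup>2 / 80"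
    by (simp only: power_mult_distrib power_mult[symmetric]) (simp add: eval_nat_numeral)
  also have "\<dots> \<le> (V i * ?h ^ 3 / 8)\<^sup>2"
    by (simp add: power_divide)
  finally show "(integral {a..b} (\<lambda>t. \<bar>v i t - w i t\<bar> * (t - mid)\<^sup>2))\<^sup>2 \<le> (V i * ?h ^ 3 / 8)\<^sup>2" .
qed

lemma error_le_const:
  assumes t_mem: "t \<in> {a..b}"
  shows "infnorm (x t - y t) \<le> 3 * input_bound V * ((exp (\<Lambda> * (b - a)) - 1) / \<Lambda>)"
proof -
  have "infnorm (x t - y t) \<le> 3 * input_bound V * ((exp (\<Lambda> * (t - a)) - 1) / \<Lambda>)"
    using error_le_exponential[OF \<Lambda>_nonzero t_mem] by (simp add: input_bound_double)
  also have "\<dots> \<le> 3 * input_bound V * ((exp (\<Lambda> * (b - a)) - 1) / \<Lambda>)"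
    using t_mem x.input_bound_nonneg by (intro mult_left_mono expm1_over_mono \<Lambda>_nonzero) auto
  finally show ?thesis .
qed

lemma affine_drift_error_le:
  assumes error_le: "\<And>t. t \<in> {a..b} \<Longrightarrow> infnorm (x t - y t) \<le> M"
  defines "h \<equiv> b - a"
  shows "infnorm (integral {a..b} (\<lambda>t. f (x t) - f (y t)))
    \<le> h / 2 * (L * infnorm (x b - y b)) + (H * K + L\<^sup>2) * (M * h\<^sup>2 / 4)
      + (H * input_bound V + L * input_lipschitz V) * (speed V * h ^ 3 / 8 + M * h\<^sup>2 / 2)"
proof -
  have "(\<Sum>i\<in>{1..m}. (H * Ki i + L * Li i)
        * (speed V * integral {a..b} (\<lambda>t. \<bar>v i t - w i t\<bar> * (t - mid)\<^sup>2) + 2 * V i * (M * h\<^sup>2 / 4)))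
      \<le> (\<Sum>i\<in>{1..m}. (H * Ki i + L * Li i) * (speed V * (V i * h ^ 3 / 8) + 2 * V i * (M * h\<^sup>2 / 4)))"
    unfolding h_def
    by (intro sum_mono mult_left_mono add_right_mono mismatch_second_moment_le x.speed_nonneg
        infnorm_lipschitz_on_nonneg[OF lie_deriv_g_lipschitz])
  also have "\<dots> = (\<Sum>i\<in>{1..m}. (H * (V i * Ki i) + L * (V i * Li i)) * (speed V * h ^ 3 / 8 + M * h\<^sup>2 / 2))"
    by (intro sum.cong) (simp_all add: field_simps)
  also have "\<dots> = (H * input_bound V + L * input_lipschitz V) * (speed V * h ^ 3 / 8 + M * h\<^sup>2 / 2)"
    by (simp add: input_bound_def input_lipschitz_def sum_distrib_right[symmetric] sum_distrib_left sum.distrib)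
  finally show ?thesis
    using drift_error_le[OF moment_zero error_le] unfolding h_def by linarith
qed

lemma affine_local_error:
  defines "h \<equiv> b - a"
  shows "(1 - L * h / 2) * infnorm (x b - y b)
    \<le> h\<^sup>2 / 4 * input_lipschitz V * (11 * K + 15 * input_bound V)
      + 3 * h ^ 3 / 4 * input_bound V * (H * (K + 2 * input_bound V) + L\<^sup>2 + 2 * L * input_lipschitz V)
          * ((exp (\<Lambda> * h) - 1) / (\<Lambda> * h))
      + h ^ 3 / 8 * (H * input_bound V + L * input_lipschitz V) * speed V"
proof -
  let ?K' = "input_bound V" and ?L' = "input_lipschitz V"
  define E where "E = (exp (\<Lambda> * h) - 1) / (\<Lambda> * h)"
  define M where "M = 3 * ?K' * (h * E)"
  have "h \<noteq> 0" using x.a_less_b by (simp add: h_def)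
  then have "M = 3 * ?K' * ((exp (\<Lambda> * h) - 1) / \<Lambda>)"
    by (simp add: M_def E_def)
  then have "infnorm (x t - y t) \<le> M" if "t \<in> {a..b}" for t
    using error_le_const[OF that] by (simp add: h_def)
  note drift = affine_drift_error_le[OF this, folded h_def]
  have "infnorm (x b - y b) \<le> infnorm (integral {a..b} (\<lambda>t. f (x t) - f (y t)))
      + ?L' * (11 * K + 15 * ?K') / 4 * h\<^sup>2"
    using input_error_le unfolding input_error_const_double h_def[symmetric]
    by (subst error_eq_integrals) (intro order_trans[OF infnorm_triangle] add_left_mono)
  with drift have "(1 - L * h / 2) * infnorm (x b - y b)
      \<le> (H * K + L\<^sup>2) * (M * h\<^sup>2 / 4) + (H * ?K' + L * ?L') * (speed V * h ^ 3 / 8 + M * h\<^sup>2 / 2)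
        + ?L' * (11 * K + 15 * ?K') / 4 * h\<^sup>2"
    by (simp add: algebra_simps)
  also have "\<dots> = h\<^sup>2 / 4 * ?L' * (11 * K + 15 * ?K')
      + 3 * h ^ 3 / 4 * ?K' * (H * (K + 2 * ?K') + L\<^sup>2 + 2 * L * ?L') * E
      + h ^ 3 / 8 * (H * ?K' + L * ?L') * speed V"
    by (simp add: M_def field_simps power2_eq_square power3_eq_cube)
  finally show ?thesis unfolding E_def .
qed

text \<open>The published constants, which are weaker than those of \<open>affine_local_error\<close>.\<close>

lemma affine_local_error_relaxed:
  assumes H'_nonneg: "0 \<le> H'"
  defines "h \<equiv> b - a"
  shows "(1 - L * h / 2 - h * input_lipschitz V) * infnorm (x b - y b)
    \<le> h\<^sup>2 / 4 * input_lipschitz V * (11 * K + 69 / 2 * input_bound V)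
      + 7 * h ^ 3 / 8 * input_bound V * ((4 * H' + H) * (K + 5 / 2 * input_bound V) + L\<^sup>2
          + (9 / 2 * L + 5 * input_lipschitz V) * input_lipschitz V) * ((exp (\<Lambda> * h) - 1) / (\<Lambda> * h))
      + 7 * h ^ 3 / 48 * (H * input_bound V + L * input_lipschitz V) * (K + input_bound V)"
proof -
  let ?K' = "input_bound V" and ?L' = "input_lipschitz V" and ?E = "(exp (\<Lambda> * h) - 1) / (\<Lambda> * h)"
  have h_pos: "0 < h" using x.a_less_b by (simp add: h_def)
  have "0 \<le> (exp (\<Lambda> * h) - 1) / \<Lambda>"
    using expm1_over_mono[OF \<Lambda>_nonzero, of 0 h] h_pos by simp
  then have "0 \<le> (exp (\<Lambda> * h) - 1) / \<Lambda> / h"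
    using h_pos by (rule divide_nonneg_pos)
  then have E_nonneg: "0 \<le> ?E"
    by (simp only: divide_divide_eq_left)
  note nonneg = x.input_bound_nonneg x.input_lipschitz_nonneg K_nonneg L_nonneg H_nonneg H'_nonneg
  have "(1 - L * h / 2 - h * ?L') * infnorm (x b - y b) \<le> (1 - L * h / 2) * infnorm (x b - y b)"
    using h_pos nonneg by (intro mult_right_mono infnorm_pos_le) simp
  also have "\<dots> \<le> h\<^sup>2 / 4 * ?L' * (11 * K + 15 * ?K')
      + 3 * h ^ 3 / 4 * ?K' * (H * (K + 2 * ?K') + L\<^sup>2 + 2 * L * ?L') * ?E
      + h ^ 3 / 8 * (H * ?K' + L * ?L') * (K + ?K')"
    using affine_local_error unfolding h_def speed_def .
  also have "\<dots> \<le> h\<^sup>2 / 4 * ?L' * (11 * K + 69 / 2 * ?K')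
      + 7 * h ^ 3 / 8 * ?K' * ((4 * H' + H) * (K + 5 / 2 * ?K') + L\<^sup>2 + (9 / 2 * L + 5 * ?L') * ?L') * ?E
      + 7 * h ^ 3 / 48 * (H * ?K' + L * ?L') * (K + ?K')"
  proof (intro add_mono mult_right_mono[OF _ E_nonneg])
    have "2 * L * ?L' \<le> (9 / 2 * L + 5 * ?L') * ?L'"
      using nonneg by (intro mult_right_mono) auto
    moreover have "H * (K + 2 * ?K') \<le> (4 * H' + H) * (K + 5 / 2 * ?K')"
      using nonneg by (intro mult_mono) auto
    ultimately show "3 * h ^ 3 / 4 * ?K' * (H * (K + 2 * ?K') + L\<^sup>2 + 2 * L * ?L')
        \<le> 7 * h ^ 3 / 8 * ?K' * ((4 * H' + H) * (K + 5 / 2 * ?K') + L\<^sup>2 + (9 / 2 * L + 5 * ?L') * ?L')"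
      using h_pos nonneg by (intro mult_mono) auto
  qed (use h_pos nonneg in \<open>auto intro!: mult_left_mono mult_right_mono\<close>)
  finally show ?thesis .
qed

end

theorem mainTheorem8:
  fixes f :: "real^'n \<Rightarrow> real^'n" and g :: "nat \<Rightarrow> real^'n \<Rightarrow> real^'n" and m :: nat
    and V Ki Li Hi W :: "nat \<Rightarrow> real" and K L H \<Lambda> :: real and B :: "(real^'n) set"
  assumes m: "m \<ge> 1"
    and V: "\<And>i. i \<in> {1..m} \<Longrightarrow> V i > 0"
    and f_C2: "C2 f"
    and g_C2: "\<And>i. i \<in> {1..m} \<Longrightarrow> C2 (g i)"
    and g_nonconst: "\<And>i. i \<in> {1..m} \<Longrightarrow> \<not> (\<exists>c. \<forall>z. g i z = c)"
    and B: "convex B"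
    and bK: "\<And>z. z \<in> B \<Longrightarrow> mnorm (f z) \<le> K"
    and bKi: "\<And>i z. i \<in> {1..m} \<Longrightarrow> z \<in> B \<Longrightarrow> mnorm (g i z) \<le> Ki i"
    and bL: "\<And>z. z \<in> B \<Longrightarrow> mat_norm (Jac f z) \<le> L"
    and bLi: "\<And>i z. i \<in> {1..m} \<Longrightarrow> z \<in> B \<Longrightarrow> mat_norm (Jac (g i) z) \<le> Li i"
    and bH: "\<And>z. z \<in> B \<Longrightarrow> d2_norm f z \<le> H"
    and bHi: "\<And>i z. i \<in> {1..m} \<Longrightarrow> z \<in> B \<Longrightarrow> d2_norm (g i) z \<le> Hi i"
    and bLam: "\<And>z. z \<in> B \<Longrightarrow> log_norm (Jac f z) \<le> \<Lambda>"
    and Lam: "\<Lambda> \<noteq> 0"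
  defines "K' \<equiv> (\<Sum>i\<in>{1..m}. V i * Ki i)"
    and "L' \<equiv> (\<Sum>i\<in>{1..m}. V i * Li i)"
    and "H' \<equiv> (\<Sum>i\<in>{1..m}. V i * Hi i)"
  shows
    "(\<exists>C. \<forall>tk tk1 x v w y.
        tk < tk1
        \<and> (\<forall>i\<in>{1..m}. v i \<in> borel_measurable lebesgue \<and> (\<forall>t. \<bar>v i t\<bar> \<le> V i))
        \<and> (\<forall>i\<in>{1..m}. w i \<in> borel_measurable (lebesgue_on {tk..tk1})
               \<and> (\<forall>t\<in>{tk..tk1}. \<bar>w i t\<bar> \<le> W i))
        \<and> is_sol f g m v tk tk1 x \<and> is_sol f g m w tk tk1 y \<and> y tk = x tk
        \<and> (\<forall>t\<in>{tk..tk1}. x t \<in> B \<and> y t \<in> B)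
        \<and> (\<forall>i\<in>{1..m}. integral {tk..tk1} (\<lambda>t. v i t - w i t) = 0
               \<and> integral {tk..tk1} (\<lambda>t. (t - (tk + tk1) / 2) * (v i t - w i t)) = 0)
        \<longrightarrow> mnorm (x tk1 - y tk1) \<le> C * (tk1 - tk)\<^sup>2)
     \<and> (\<forall>tk tk1 x v w y.
        tk < tk1
        \<and> (\<forall>i\<in>{1..m}. v i \<in> borel_measurable lebesgue \<and> (\<forall>t. \<bar>v i t\<bar> \<le> V i))
        \<and> (\<forall>i\<in>{1..m}. \<exists>a b. \<forall>t\<in>{tk..tk1}. w i t = a + b * t)
        \<and> is_sol f g m v tk tk1 x \<and> is_sol f g m w tk tk1 y \<and> y tk = x tk
        \<and> (\<forall>t\<in>{tk..tk1}. x t \<in> B \<and> y t \<in> B)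
        \<and> (\<forall>i\<in>{1..m}. integral {tk..tk1} (\<lambda>t. v i t - w i t) = 0
               \<and> integral {tk..tk1} (\<lambda>t. (t - (tk + tk1) / 2) * (v i t - w i t)) = 0)
        \<longrightarrow> (let h = tk1 - tk; E = (exp (\<Lambda> * h) - 1) / (\<Lambda> * h) in
             (1 - L * h / 2 - h * L') * mnorm (x tk1 - y tk1)
             \<le> h\<^sup>2 / 4 * L' * (11 * K + 69 / 2 * K')
              + 7 * h ^ 3 / 8 * K' * ((4 * H' + H) * (K + 5 / 2 * K') + L\<^sup>2 + (9 / 2 * L + 5 * L') * L') * E
              + 7 * h ^ 3 / 48 * (H * K' + L * L') * (K + K')))"
proof -
  have system: "bounded_system f g m B K L H \<Lambda> Ki Li" if "z \<in> B" for z
    by unfold_locales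
      (use that f_C2 g_C2 B bK bKi bL bLi bH bLam in \<open>auto simp: C2_def mnorm_eq_infnorm\<close>)
  show ?thesis
  proof (intro conjI exI allI impI, goal_cases)
    case (1 a b x v w y)
    interpret bounded_system f g m B K L H \<Lambda> Ki Li
      by (rule system[of "x a"]) (use 1 in auto)
    interpret matched_pair f g m B K L H \<Lambda> Ki Li a b v V x w W y
      by unfold_locales (use 1 in \<open>auto intro: measurable_restrict_space1\<close>)
    show "mnorm (x b - y b) \<le> local_error_const V W * (b - a)\<^sup>2"
      unfolding mnorm_eq_infnorm by (rule local_error_quadratic)
  next
    case (2 a b x v w y)
    then have "x a \<in> B" by auto
    interpret bounded_system f g m B K L H \<Lambda> Ki Li
      by (rule system[OF \<open>x a \<in> B\<close>])
    interpret affine_matched_pair f g m B K L H \<Lambda> Ki Li a b v V x w y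
      by unfold_locales (use 2 Lam in \<open>auto intro: measurable_restrict_space1\<close>)
    have "0 \<le> Hi i" if "i \<in> {1..m}" for i
      using order_trans[OF d2_norm_nonneg bHi[OF that \<open>x a \<in> B\<close>]] g_C2[OF that] by (simp add: C2_def)
    then have "0 \<le> H'"
      unfolding H'_def by (intro sum_nonneg mult_nonneg_nonneg x.U_nonneg)
    from affine_local_error_relaxed[OF this] show ?case
      unfolding Let_def mnorm_eq_infnorm K'_def L'_def input_bound_def input_lipschitz_def .
  qed
qed

end
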